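(* Let $\nu\in\mathbb{C}$, let $a>0$ be real, and let $p\in\mathbb{C}$ with $\operatorname{Re}p>0$. Then $$ D_\nu\left(a\sqrt p\right)D_{-\nu-1}\left(a\sqrt p\right)=\int_{\frac12a^2}^\infty e^{-pt}\,\frac{a\left(t^2-\frac{a^4}{4}\right)^{-1/2}}{\sqrt{2\pi t}}\cos\left[(2\nu+1)\arcsin\left[\sqrt{\frac{2t-a^2}{4t}}\right]\right]dt . $$
   Context: $D_\nu(z)$ is Whittaker's parabolic cylinder function of order $\nu$, the entire function of $z$ given by $$D_\nu(z)=2^{\nu/2}e^{-z^2/4}\left\{\frac{\Gamma[1/2]}{\Gamma[(1-\nu)/2]}\Phi\left(-\frac{\nu}{2};\frac12;\frac{z^2}{2}\right)+\frac{z}{2^{1/2}}\frac{\Gamma[-1/2]}{\Gamma[-\nu/2]}\Phi\left(\frac{1-\nu}{2};\frac32;\frac{z^2}{2}\right)\right\},$$ where $\Gamma[\cdot]$ is the gamma function (with $1/\Gamma$ taken to be $0$ at the nonpositive integers) and $\Phi(a;b;z)=\sum_{n\ge0}\frac{(a)_n}{(b)_n}\frac{z^n}{n!}$ is Kummer's confluent hypergeometric function. Square roots are principal values. *)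

theory Defs
  imports "HOL-Analysis.Analysis"
begin

text \<open>Kummer's function \<open>\<Phi>(a;b;z)\<close>, meaningful when \<open>b\<close> is not a nonpositive integer;
  it is only used with \<open>b = 1/2\<close> and \<open>b = 3/2\<close>.\<close>

definition kummer_Phi :: "complex \<Rightarrow> complex \<Rightarrow> complex \<Rightarrow> complex" where
  "kummer_Phi a b z = (\<Sum>n. pochhammer a n / pochhammer b n * (z ^ n / fact n))"

text \<open>Whittaker's parabolic cylinder function \<open>D\<^sub>\<nu>(z)\<close>. The library's \<^const>\<open>rGamma\<close> is
  \<open>1/\<Gamma>\<close>, extended by \<open>0\<close> to the nonpositive integers.\<close>

definition parabolic_cylinder_D :: "complex \<Rightarrow> complex \<Rightarrow> complex" where
  "parabolic_cylinder_D \<nu> z =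
     2 powr (\<nu> / 2) * exp (- (z ^ 2) / 4) *
       (Gamma (1 / 2) * rGamma ((1 - \<nu>) / 2) * kummer_Phi (- \<nu> / 2) (1 / 2) (z ^ 2 / 2)
        + z / csqrt 2 * (Gamma (- 1 / 2) * rGamma (- \<nu> / 2))
            * kummer_Phi ((1 - \<nu>) / 2) (3 / 2) (z ^ 2 / 2))"

end

theory Submission
  imports Defs "HOL-Complex_Analysis.Conformal_Mappings" "HOL-Probability.Distributions"
    "HOL-Real_Asymp.Real_Asymp"
begin

text \<open>Put \<open>z = a \<surd>p\<close>, \<open>\<alpha> = \<nu> + 1/2\<close> and \<open>t = a\<^sup>2 / (2 cos x)\<close>. The right-hand side becomes
  \<open>I(z) = \<pi>\<^sup>-\<^sup>1\<^sup>/\<^sup>2 \<integral> exp(-z\<^sup>2 / (2 cos x)) cos(\<alpha> x) cos\<^sup>-\<^sup>1\<^sup>/\<^sup>2 x dx\<close> over \<open>0 < x < \<pi>/2\<close>.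
  The functions \<open>u = D\<^sub>-\<^sub>\<nu>\<^sub>-\<^sub>1\<close> and \<open>v = D\<^sub>\<nu>\<close> satisfy \<open>u'' = (z\<^sup>2/4 + \<alpha>) u\<close> and \<open>v'' = (z\<^sup>2/4 - \<alpha>) v\<close>, so that
  \<open>u v\<close>, its derivative, \<open>u' v'\<close> and \<open>u v' - u' v\<close> solve a linear first-order system. Integration by parts shows that
  \<open>I\<close> and three companion integrals solve the same system for \<open>z > 0\<close>. Their limits at \<open>z = 0\<close> follow from Cauchy's
  evaluation of \<open>\<integral> cos\<^sup>s\<^sup>-\<^sup>1 x cos(\<alpha> x) dx\<close> for \<open>s = 1/2, 3/2\<close> and from the Gaussian integral, and agree with the initial
  values of the product. Gronwall's argument gives equality for \<open>z > 0\<close>, and analytic continuation in \<open>p\<close> the rest.\<close>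

section \<open>Laplace integrals over a quarter period\<close>

text \<open>The two factors satisfy different equations, with +\<alpha> and -\<alpha>, so the
  Wronskian-type term u v' - u' v is not constant: its derivative is -2 \<alpha> u v. Hence a fourth
  unknown is carried along. The system has polynomial coefficients and is regular at z = 0, so four
  initial values decide everything; the obstacle is that two of the companion integrals carry the
  exponent -3/2, whose integral diverges at z = 0 and must be multiplied by z before the limit is
  taken. The initial values come in two pairs. For u v and u' v' the integrals converge and give
  Cauchy's products of reciprocal Gammas. For the mixed products u' v and u v' the singular
  integrals leave only a boundary value at pi/2, a cosine or sine of \<alpha> pi/2, which the
  reflection formula of Gamma matches. Differentiation and integration by parts both shift the
  exponent of cos x by integers, which is why a family with free exponent and free amplitude is
  studied rather than one integral.\<close>

definition quarter :: "real measure" where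
  "quarter = restrict_space lborel {0<..<pi/2}"

lemma space_quarter [simp]: "space quarter = {0<..<pi/2}"
  by (simp add: quarter_def space_restrict_space)

lemma integrable_quarter_iff:
  "integrable quarter f \<longleftrightarrow> set_integrable lborel {0<..<pi/2} f"
  for f :: "real \<Rightarrow> 'a::{banach, second_countable_topology}"
  by (simp add: quarter_def integrable_restrict_space set_integrable_def)

lemma integral_quarter_eq:
  "integral\<^sup>L quarter f = (LBINT x:{0<..<pi/2}. f x)"
  for f :: "real \<Rightarrow> 'a::{banach, second_countable_topology}"
  by (simp add: quarter_def integral_restrict_space set_lebesgue_integral_def)

lemma borel_measurable_quarter:
  assumes "continuous_on {0<..<pi/2} f"
  shows "f \<in> borel_measurable quarter"
proof -
  have "sets quarter = sets (restrict_space borel {0<..<pi/2})"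
    unfolding quarter_def by (intro sets_restrict_space_cong) auto
  then show ?thesis
    using borel_measurable_continuous_on_restrict[OF assms] measurable_cong_sets by blast
qed

lemma integrable_quarter_const [simp]:
  "integrable quarter (\<lambda>x. c :: 'a::{banach, second_countable_topology})"
  by (simp add: integrable_quarter_iff set_integrable_def)

text \<open>Improper form of the fundamental theorem: only one-sided limits of \<open>F\<close>
  enter, because primitives containing \<open>exp (- w / cos x)\<close> or negative powers of
  \<open>cos x\<close> take a meaningless default value at pi/2.\<close>

lemma integral_quarter_FTC:
  fixes F f :: "real \<Rightarrow> complex"
  assumes F: "\<And>x. x \<in> {0<..<pi/2} \<Longrightarrow> (F has_vector_derivative f x) (at x)"
    and f: "continuous_on {0<..<pi/2} f" "integrable quarter f"
    and lim: "(F \<longlongrightarrow> A) (at_right 0)" "(F \<longlongrightarrow> B) (at_left (pi/2))"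
  shows "integral\<^sup>L quarter f = B - A"
proof -
  have "(LBINT x=ereal 0..ereal (pi/2). f x) = B - A"
  proof (rule interval_integral_FTC_integrable[of _ _ F])
    show "isCont f x" if "ereal 0 < ereal x" "ereal x < ereal (pi/2)" for x
      using f(1) that by (auto simp: continuous_on_eq_continuous_at)
    show "set_integrable lborel (einterval (ereal 0) (ereal (pi/2))) f"
      using f(2) by (simp add: integrable_quarter_iff)
  qed (use F lim in \<open>auto simp: ereal_tendsto_simps\<close>)
  then show ?thesis
    by (simp add: integral_quarter_eq interval_lebesgue_integral_le_eq)
qed

text \<open>The cosine has a simple zero at pi/2; this minorant turns that into a comparison with
  the distance to pi/2. The constant 1/2 is a weakening of Jordan's 2/pi that the cubic Taylor
  estimate for sin delivers.\<close>

lemma cos_ge_linear: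
  assumes "0 \<le> x" "x \<le> pi/2"
  shows "(pi/2 - x) / 2 \<le> cos x"
proof -
  define y where "y = pi/2 - x"
  have y: "0 \<le> y" "y \<le> 8/5" using assms pi_approx by (auto simp: y_def)
  have "\<bar>sin y - (\<Sum>m<3. (if even m then 0 else (- 1) ^ ((m - Suc 0) div 2) / fact m) * y ^ m)\<bar>
      \<le> inverse (fact 3) * \<bar>y\<bar> ^ 3"
    using Maclaurin_sin_bound[of y 3] by (simp add: sin_coeff_def)
  then have "\<bar>sin y - y\<bar> \<le> y ^ 3 / 6"
    using y by (simp add: numeral_3_eq_3 fact_numeral)
  then have "sin y \<ge> y - y ^ 3 / 6" by linarith
  \<comment> \<open>Here (8/5)^2 = 2.56 is below 3, so the cubic term takes away at most half of
    \<open>y\<close>.\<close>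
  moreover have "y * y\<^sup>2 \<le> y * (8/5)\<^sup>2" using y by (intro mult_left_mono power_mono) auto
  then have "y ^ 3 \<le> 3 * y" using y by (simp add: power3_eq_cube power2_eq_square)
  ultimately have "y / 2 \<le> sin y" by simp
  then show ?thesis by (simp add: y_def sin_cos_eq)
qed

text \<open>For negative \<open>r\<close> the power of \<open>cos x\<close> lies below the same
  power of its linear minorant, which has an explicit primitive; for nonnegative \<open>r\<close> it
  is at most 1. The majorant \<open>1 + ((pi/2 - x) / 2) powr r\<close> covers both signs.\<close>

lemma integrable_cos_powr:
  assumes "r > -1"
  shows "integrable quarter (\<lambda>x. cos x powr r)"
proof -
  have "set_integrable lborel (einterval (ereal 0) (ereal (pi/2))) (\<lambda>x. ((pi/2 - x) / 2) powr r)"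
  proof (rule interval_integral_FTC_nonneg)
    show "((\<lambda>x. - 2 / (r + 1) * ((pi/2 - x) / 2) powr (r + 1)) has_real_derivative ((pi/2 - x) / 2) powr r) (at x)"
      if "ereal 0 < ereal x" "ereal x < ereal (pi/2)" for x
    proof -
      have "((\<lambda>x. ((pi/2 - x) / 2) powr (r + 1)) has_real_derivative (r + 1) * ((pi/2 - x) / 2) powr r * (- 1/2)) (at x)"
        using DERIV_fun_powr[of "\<lambda>x. (pi/2 - x) / 2" "-1/2" x "r + 1"] that
        by (auto intro!: derivative_eq_intros)
      then show ?thesis
        using assms by (auto dest: DERIV_cmult[of _ _ _ _ "- 2 / (r + 1)"])
    qed
    show "isCont (\<lambda>x. ((pi/2 - x) / 2) powr r) x" if "ereal 0 < ereal x" "ereal x < ereal (pi/2)" for x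
      using that by (auto intro!: continuous_intros)
    show "(((\<lambda>x. - 2 / (r + 1) * ((pi/2 - x) / 2) powr (r + 1)) \<circ> real_of_ereal) \<longlongrightarrow>
        - 2 / (r + 1) * ((pi/2 - 0) / 2) powr (r + 1)) (at_right (ereal 0))"
      unfolding ereal_tendsto_simps by (intro tendsto_intros) auto
    have "((\<lambda>x. - 2 / (r + 1) * ((pi/2 - x) / 2) powr (r + 1)) \<longlongrightarrow> - 2 / (r + 1) * 0) (at_left (pi/2))"
    proof (intro tendsto_intros tendsto_zero_powrI)
      show "((\<lambda>x. (pi/2 - x) / 2) \<longlongrightarrow> 0) (at_left (pi/2))"
        by (auto intro!: tendsto_eq_intros)
      show "\<forall>\<^sub>F x in at_left (pi/2). 0 \<le> (pi/2 - x) / 2"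
        by (intro eventually_at_leftI[of 0]) auto
    qed (use assms in auto)
    then show "(((\<lambda>x. - 2 / (r + 1) * ((pi/2 - x) / 2) powr (r + 1)) \<circ> real_of_ereal) \<longlongrightarrow> 0) (at_left (ereal (pi/2)))"
      unfolding ereal_tendsto_simps by simp
  qed auto
  then have "integrable quarter (\<lambda>x. ((pi/2 - x) / 2) powr r)"
    by (simp add: integrable_quarter_iff)
  then have "integrable quarter (\<lambda>x. 1 + ((pi/2 - x) / 2) powr r)"
    by simp
  then show ?thesis
  proof (rule Bochner_Integration.integrable_bound)
    show "(\<lambda>x. cos x powr r) \<in> borel_measurable quarter"
      using cos_gt_zero by (intro borel_measurable_quarter continuous_intros) force
    have "norm (cos x powr r) \<le> norm (1 + ((pi/2 - x) / 2) powr r)" if "x \<in> {0<..<pi/2}" for x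
    proof (cases "r \<ge> 0")
      case True
      then have "cos x powr r \<le> 1"
        using that cos_gt_zero[of x] powr_mono2[of r "cos x" 1] by auto
      moreover have "0 \<le> ((pi/2 - x) / 2) powr r" by simp
      ultimately have "cos x powr r \<le> 1 + ((pi/2 - x) / 2) powr r" by linarith
      then show ?thesis by simp
    next
      case False
      have "cos x powr r \<le> ((pi/2 - x) / 2) powr r"
      proof (rule powr_mono2')
        show "(pi/2 - x) / 2 \<le> cos x" using that by (intro cos_ge_linear) auto
      qed (use that False in auto)
      then show ?thesis by simp
    qed
    then show "AE x in quarter. norm (cos x powr r) \<le> norm (1 + ((pi/2 - x) / 2) powr r)"
      by (intro AE_I2) auto
  qed
qed

text \<open>A single term of the exponential series gives (\<delta>/c)^n \<le> n! exp(\<delta>/c),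
  so exponential decay in 1/c beats every negative power of c. This lets the exponent of cos x be
  lowered without limit when Re w > 0.\<close>

lemma exp_powr_bound:
  fixes \<delta> r :: real
  assumes "\<delta> > 0"
  obtains K where "K \<ge> 0" "\<And>c. 0 < c \<Longrightarrow> c \<le> 1 \<Longrightarrow> exp (- \<delta> / c) * c powr r \<le> K"
proof -
  define n where "n = nat \<lceil>- r\<rceil>"
  have n: "- r \<le> real n" unfolding n_def by linarith
  have "exp (- \<delta> / c) * c powr r \<le> fact n / \<delta> ^ n" if c: "0 < c" "c \<le> 1" for c
  proof -
    have "c powr r \<le> c powr (- real n)" using n c by (intro powr_mono') auto
    also have "\<dots> = (1 / c) ^ n" using c by (simp add: powr_minus powr_realpow field_simps)
    finally have 1: "c powr r \<le> (1 / c) ^ n" .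
    have "(\<delta> / c) ^ n / fact n \<le> exp (\<delta> / c)"
      using assms c sum_le_suminf[OF summable_exp_generic[of "\<delta> / c"], of "{n}"]
      by (simp add: exp_def divide_inverse mult_ac)
    then have 2: "(1 / c) ^ n \<le> fact n / \<delta> ^ n * exp (\<delta> / c)"
      using assms c by (simp add: field_simps)
    have "exp (- \<delta> / c) * c powr r \<le> exp (- \<delta> / c) * (fact n / \<delta> ^ n * exp (\<delta> / c))"
      using 1 2 by (intro mult_left_mono) auto
    then show ?thesis by (simp add: exp_minus field_simps)
  qed
  then show ?thesis using assms by (intro that[of "fact n / \<delta> ^ n"]) auto
qed

text \<open>With \<open>h(t)\<close> the density obtained from \<open>g(x) cos\<^sup>r x\<close> by \<open>t = 1 / cos x\<close>, this is the Laplace transform of \<open>h\<close> at \<open>w\<close>;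
  hence differentiation in \<open>w\<close> lowers \<open>r\<close> by one.\<close>

definition arc_laplace :: "real \<Rightarrow> (complex \<Rightarrow> complex) \<Rightarrow> complex \<Rightarrow> complex" where
  "arc_laplace r g w =
    (\<integral>x. exp (- w / of_real (cos x)) * of_real (cos x powr r) * g (of_real x) \<partial>quarter)"

lemma bounded_on_quarter:
  fixes g :: "complex \<Rightarrow> complex"
  assumes "continuous_on UNIV g"
  obtains B where "B \<ge> 0" "\<And>x. x \<in> {0<..<pi/2} \<Longrightarrow> norm (g (of_real x)) \<le> B"
proof -
  have "compact ((\<lambda>x. g (of_real x)) ` {0..pi/2})"
    by (intro compact_continuous_image continuous_on_compose2[OF assms] continuous_intros) auto
  then obtain B where "\<And>y. y \<in> (\<lambda>x. g (of_real x)) ` {0..pi/2} \<Longrightarrow> norm y \<le> B"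
    using compact_imp_bounded bounded_iff by metis
  then have B: "norm (g (of_real x)) \<le> B" if "x \<in> {0..pi/2}" for x using that by auto
  have "B \<ge> 0" using order_trans[OF norm_ge_zero B[of 0]] by simp
  then show ?thesis
  proof (rule that)
    show "norm (g (of_real x)) \<le> B" if "x \<in> {0<..<pi/2}" for x
      using that by (intro B) auto
  qed
qed

lemma continuous_arc_integrand:
  fixes g :: "complex \<Rightarrow> complex"
  assumes "continuous_on UNIV g"
  shows "continuous_on {0<..<pi/2} (\<lambda>x. exp (- w / of_real (cos x)) * of_real (cos x powr r) * g (of_real x))"
proof -
  have c: "cos x \<noteq> 0" if "x \<in> {0<..<pi/2}" for x
    using cos_gt_zero[of x] that by auto
  have "continuous_on {0<..<pi/2} (\<lambda>x. g (of_real x))"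
    by (rule continuous_on_compose2[OF assms]) (auto intro: continuous_intros)
  moreover have "continuous_on {0<..<pi/2} (\<lambda>x. exp (- w / of_real (cos x)))"
    using c by (intro continuous_intros) auto
  moreover have "continuous_on {0<..<pi/2} (\<lambda>x. complex_of_real (cos x powr r))"
    using c by (intro continuous_on_of_real continuous_intros) auto
  ultimately show ?thesis by (intro continuous_on_mult)
qed

lemma integrable_quarter_cos_powr_bound:
  fixes f :: "real \<Rightarrow> complex"
  assumes "r > -1" "continuous_on {0<..<pi/2} f"
    "\<And>x. x \<in> {0<..<pi/2} \<Longrightarrow> norm (f x) \<le> K * cos x powr r"
  shows "integrable quarter f"
proof (rule Bochner_Integration.integrable_bound)
  show "integrable quarter (\<lambda>x. K * cos x powr r)"
    using integrable_cos_powr[OF assms(1)] by simp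
  show "f \<in> borel_measurable quarter" by (rule borel_measurable_quarter) (rule assms)
  show "AE x in quarter. norm (f x) \<le> norm (K * cos x powr r)"
    using assms(3) by (intro AE_I2) (force intro: order_trans[OF _ abs_ge_self])
qed

lemma norm_exp_arc: "norm (exp (- w / of_real c)) = exp (- Re w / c)" for c :: real
  using Re_divide_of_real[of "- w" c] by simp

text \<open>For Re w > 0 the exponential decays at pi/2 faster than any power of cos x, so every
  \<open>r\<close> is allowed; for Re w = 0 it has modulus 1 and cos^r x itself must be integrable.
  The second regime serves the limit z = 0.\<close>

lemma integrable_arc_laplace:
  fixes g :: "complex \<Rightarrow> complex"
  assumes g: "continuous_on UNIV g" and w: "Re w > 0 \<or> Re w \<ge> 0 \<and> r > -1"
  shows "integrable quarter (\<lambda>x. exp (- w / of_real (cos x)) * of_real (cos x powr r) * g (of_real x))"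
proof -
  obtain B where B: "B \<ge> 0" "\<And>x. x \<in> {0<..<pi/2} \<Longrightarrow> norm (g (of_real x)) \<le> B"
    using bounded_on_quarter[OF g] by auto
  show ?thesis
  proof (cases "r > -1")
    case True
    show ?thesis
    proof (rule integrable_quarter_cos_powr_bound[OF True continuous_arc_integrand[OF g]])
      fix x :: real assume x: "x \<in> {0<..<pi/2}"
      then have "cos x > 0" by (simp add: cos_gt_zero)
      then have "exp (- Re w / cos x) \<le> 1" using w by auto
      then show "norm (exp (- w / of_real (cos x)) * of_real (cos x powr r) * g (of_real x)) \<le> B * cos x powr r"
        using B(2)[OF x] \<open>exp (- Re w / cos x) \<le> 1\<close>
          mult_mono[OF mult_right_mono[of "exp (- Re w / cos x)" 1 "cos x powr r"], of "norm (g (of_real x))" B]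
        by (simp add: norm_mult norm_exp_arc mult.commute)
    qed
  next
    case False
    then have "Re w > 0" using w by auto
    then obtain K where K: "K \<ge> 0" "\<And>c. 0 < c \<Longrightarrow> c \<le> 1 \<Longrightarrow> exp (- Re w / c) * c powr r \<le> K"
      using exp_powr_bound by metis
    show ?thesis
    proof (rule integrable_quarter_cos_powr_bound[of 0, OF _ continuous_arc_integrand[OF g]])
      fix x :: real assume x: "x \<in> {0<..<pi/2}"
      then have c: "cos x > 0" by (simp add: cos_gt_zero)
      have "exp (- Re w / cos x) * cos x powr r * norm (g (of_real x)) \<le> K * B"
        using K(2)[OF c] B(2)[OF x] K(1) by (intro mult_mono) auto
      then show "norm (exp (- w / of_real (cos x)) * of_real (cos x powr r) * g (of_real x)) \<le> K * B * cos x powr 0"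
        using c unfolding norm_mult norm_exp_arc by simp
    qed auto
  qed
qed

section \<open>Shift rules, differentiation in \<open>w\<close> and integration by parts\<close>

lemma arc_laplace_add:
  assumes "continuous_on UNIV g" "continuous_on UNIV h" "Re w > 0 \<or> Re w \<ge> 0 \<and> r > -1"
  shows "arc_laplace r (\<lambda>z. g z + h z) w = arc_laplace r g w + arc_laplace r h w"
  unfolding arc_laplace_def distrib_left
  using assms by (intro Bochner_Integration.integral_add integrable_arc_laplace)

lemma arc_laplace_mult:
  "arc_laplace r (\<lambda>z. k * g z) w = k * arc_laplace r g w"
  unfolding arc_laplace_def by (subst integral_mult_right_zero[symmetric]) (simp add: mult.left_commute)

lemma arc_laplace_cos_mult:
  "arc_laplace r (\<lambda>z. cos z * g z) w = arc_laplace (r + 1) g w"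
  unfolding arc_laplace_def
proof (rule Bochner_Integration.integral_cong[OF refl])
  fix x :: real assume "x \<in> space quarter"
  then have "cos x > 0" by (simp add: cos_gt_zero)
  then have "of_real (cos x powr (r + 1)) = of_real (cos x powr r) * (of_real (cos x) :: complex)"
    by (simp add: powr_add)
  then show "exp (- w / of_real (cos x)) * of_real (cos x powr r) * (cos (of_real x) * g (of_real x)) =
      exp (- w / of_real (cos x)) * of_real (cos x powr (r + 1)) * g (of_real x)"
    by (simp add: cos_of_real)
qed

text \<open>Writing sin^2 z = 1 - cos^2 z trades a squared sine in the amplitude for a shift of the
  exponent by two. Integrating the derivative of sin z cos(\<alpha> z) by parts produces such
  squares, and this returns them to pure cosine amplitudes.\<close>

lemma arc_laplace_sin_squared_mult:
  assumes g: "continuous_on UNIV g" and w: "Re w > 0 \<or> Re w \<ge> 0 \<and> r > -1"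
  shows "arc_laplace r (\<lambda>z. sin z * (sin z * g z)) w = arc_laplace r g w - arc_laplace (r + 2) g w"
proof -
  have "sin z * (sin z * g z) = g z + (- 1) * (cos z * (cos z * g z))" for z
  proof -
    have "sin z * (sin z * g z) = (sin z)\<^sup>2 * g z" by (simp add: power2_eq_square)
    also have "\<dots> = (1 - (cos z)\<^sup>2) * g z" by (simp only: sin_squared_eq)
    finally show ?thesis by (simp add: power2_eq_square algebra_simps)
  qed
  then have "arc_laplace r (\<lambda>z. sin z * (sin z * g z)) w
      = arc_laplace r (\<lambda>z. g z + (- 1) * (cos z * (cos z * g z))) w" by simp
  also have "\<dots> = arc_laplace r g w + arc_laplace r (\<lambda>z. (- 1) * (cos z * (cos z * g z))) w"
    by (intro arc_laplace_add g w continuous_intros)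
  also have "\<dots> = arc_laplace r g w - arc_laplace (r + 1 + 1) g w"
    by (simp only: arc_laplace_mult arc_laplace_cos_mult) simp
  also have "r + 1 + 1 = r + 2" by simp
  finally show ?thesis .
qed

lemma has_field_derivative_quadratic_error:
  fixes f :: "'a::real_normed_field \<Rightarrow> 'a"
  assumes "\<delta> > 0" and err: "\<And>h. norm h < \<delta> \<Longrightarrow> norm (f (p + h) - f p - h * D) \<le> K * (norm h)\<^sup>2"
  shows "(f has_field_derivative D) (at p)"
  unfolding DERIV_def
proof (rule Lim_null_comparison[of _ "\<lambda>h. K * norm h", THEN Lim_null[THEN iffD2]])
  show "\<forall>\<^sub>F h in at 0. norm ((f (p + h) - f p) / h - D) \<le> K * norm h"
    unfolding eventually_at
  proof (intro exI[of _ \<delta>] conjI ballI impI)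
    fix h :: 'a assume h: "h \<noteq> 0 \<and> dist h 0 < \<delta>"
    then have "(f (p + h) - f p) / h - D = (f (p + h) - f p - h * D) / h" by (simp add: field_simps)
    then have "norm ((f (p + h) - f p) / h - D) = norm (f (p + h) - f p - h * D) / norm h"
      by (simp add: norm_divide)
    also have "\<dots> \<le> K * (norm h)\<^sup>2 / norm h" using h by (intro divide_right_mono err) auto
    also have "\<dots> = K * norm h" using h by (simp add: power2_eq_square)
    finally show "norm ((f (p + h) - f p) / h - D) \<le> K * norm h" .
  qed (use assms in auto)
  show "((\<lambda>h. K * norm h) \<longlongrightarrow> 0) (at (0::'a))"
    by (auto intro!: tendsto_eq_intros)
qed

text \<open>Pointwise, the error of the linear approximation is the integrand times exp(u) - 1 - u
  with u = -h / cos x. Its quadratic bound is integrable because Re w > 0, so one explicit estimate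
  replaces a limit under the integral sign.\<close>

lemma arc_laplace_has_field_derivative:
  assumes g: "continuous_on UNIV g" and w: "Re w > 0"
  shows "(arc_laplace r g has_field_derivative - arc_laplace (r - 1) g w) (at w)"
proof (rule has_field_derivative_quadratic_error)
  \<comment> \<open>Half of Re w absorbs the factor exp(|h| / cos x) of the Taylor remainder; the
    other half remains as decay.\<close>
  define \<delta> where "\<delta> = Re w / 2"
  show "\<delta> > 0" using w by (simp add: \<delta>_def)
  define E where "E r w x = exp (- w / of_real (cos x)) * of_real (cos x powr r) * g (of_real x)" for r w x
  have L: "arc_laplace r g w = integral\<^sup>L quarter (E r w)" for r w
    by (simp add: arc_laplace_def E_def[abs_def])
  have int: "integrable quarter (E r v)" if "Re v > 0" for r v
    unfolding E_def using g that by (intro integrable_arc_laplace) auto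
  \<comment> \<open>The exponent r - 2 comes from |u|^2 = |h|^2 / cos^2 x.\<close>
  define K where "K = (\<integral>x. norm (E (r - 2) (of_real \<delta>) x) \<partial>quarter)"
  fix h :: complex assume h: "norm h < \<delta>"
  then have wh: "Re (w + h) > 0" using abs_Re_le_cmod[of h] w by (simp add: \<delta>_def)
  have "arc_laplace r g (w + h) - arc_laplace r g w - h * - arc_laplace (r - 1) g w
      = (\<integral>x. E r (w + h) x - E r w x + h * E (r - 1) w x \<partial>quarter)"
    unfolding L using int[OF wh] int[OF w] by simp
  also have "norm \<dots> \<le> (\<integral>x. (norm h)\<^sup>2 * norm (E (r - 2) (of_real \<delta>) x) \<partial>quarter)"
  proof (rule order_trans[OF integral_norm_bound integral_mono])
    show "integrable quarter (\<lambda>x. norm (E r (w + h) x - E r w x + h * E (r - 1) w x))"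
      using int[OF wh] int[OF w] by (intro integrable_norm) simp
    show "integrable quarter (\<lambda>x. (norm h)\<^sup>2 * norm (E (r - 2) (of_real \<delta>) x))"
      using \<open>\<delta> > 0\<close> by (intro integrable_mult_right integrable_norm int) simp
    fix x assume "x \<in> space quarter"
    then have c: "cos x > 0" by (simp add: cos_gt_zero)
    define u where "u = - h / of_real (cos x)"
    have p1: "of_real (cos x powr (r - 1)) = of_real (cos x powr r) / (of_real (cos x) :: complex)"
      using c by (simp add: powr_diff)
    have "E r (w + h) x - E r w x + h * E (r - 1) w x
       = (exp u - 1 - u) * (exp (- w / of_real (cos x)) * of_real (cos x powr r) * g (of_real x))"
    proof -
      have e: "exp (- (w + h) / of_real (cos x)) = exp (- w / of_real (cos x)) * exp u"
        unfolding exp_add[symmetric] by (simp add: u_def diff_divide_distrib)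
      have m: "h * (P * (R / of_real (cos x)) * G) = - u * (P * R * G)" for P R G
        by (simp add: u_def)
      show ?thesis
        unfolding E_def p1 e m by (simp add: algebra_simps)
    qed
    also have "norm \<dots> \<le> (exp (norm h / cos x) * (norm h / cos x)\<^sup>2) *
        (exp (- Re w / cos x) * cos x powr r * norm (g (of_real x)))"
    proof -
      have nu: "norm u = norm h / cos x" using c by (simp add: u_def norm_divide)
      have "norm (exp u - 1 - u) \<le> exp (norm u) * (norm u)\<^sup>2"
        using Taylor_exp_field[of u 1] by (simp add: algebra_simps power2_eq_square)
      then show ?thesis unfolding norm_mult norm_exp_arc nu
        by (simp add: mult_right_mono)
    qed
    also have "\<dots> = (norm h)\<^sup>2 * (exp (norm h / cos x - Re w / cos x) * (cos x powr r / (cos x)\<^sup>2) * norm (g (of_real x)))"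
      by (simp add: exp_diff exp_minus power_divide field_simps)
    also have "cos x powr r / (cos x)\<^sup>2 = cos x powr (r - 2)"
      using c by (simp add: powr_diff powr_numeral)
    also have "(norm h)\<^sup>2 * (exp (norm h / cos x - Re w / cos x) * cos x powr (r - 2) * norm (g (of_real x)))
        \<le> (norm h)\<^sup>2 * (exp (- \<delta> / cos x) * cos x powr (r - 2) * norm (g (of_real x)))"
    proof -
      have "norm h - Re w \<le> - \<delta>" using h by (simp add: \<delta>_def)
      then have "(norm h - Re w) / cos x \<le> - \<delta> / cos x" using c by (intro divide_right_mono) auto
      then show ?thesis by (intro mult_left_mono mult_right_mono) (auto simp: diff_divide_distrib)
    qed
    also have "\<dots> = (norm h)\<^sup>2 * norm (E (r - 2) (of_real \<delta>) x)"
      unfolding E_def norm_mult norm_exp_arc by simp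
    finally show "norm (E r (w + h) x - E r w x + h * E (r - 1) w x) \<le> (norm h)\<^sup>2 * norm (E (r - 2) (of_real \<delta>) x)" .
  qed
  also have "\<dots> = K * (norm h)\<^sup>2" by (simp add: K_def)
  finally show "norm (arc_laplace r g (w + h) - arc_laplace r g w - h * - arc_laplace (r - 1) g w)
      \<le> K * (norm h)\<^sup>2" .
qed

lemma tendsto_cos_at_left_half_pi: "(cos \<longlongrightarrow> (0::real)) (at_left (pi/2))"
  using isCont_cos[of "pi/2::real"] by (simp add: isCont_def filterlim_at_split)

lemma filterlim_cos_at_left_half_pi: "filterlim cos (at_right (0::real)) (at_left (pi/2))"
  unfolding filterlim_at
proof
  have "cos x \<in> {0<..} \<and> cos x \<noteq> 0" if "x \<in> {0<..<pi/2}" for x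
    using cos_gt_zero[of x] that by auto
  then show "\<forall>\<^sub>F x in at_left (pi/2). cos x \<in> {0<..} \<and> cos x \<noteq> 0"
    by (intro eventually_at_leftI[of 0]) auto
qed (rule tendsto_cos_at_left_half_pi)

lemma tendsto_zero_cos_powr_bound:
  fixes F :: "real \<Rightarrow> complex"
  assumes "r > 0" "\<And>x. x \<in> {0<..<pi/2} \<Longrightarrow> norm (F x) \<le> K * cos x powr r"
  shows "(F \<longlongrightarrow> 0) (at_left (pi/2))"
proof (rule Lim_null_comparison)
  show "\<forall>\<^sub>F x in at_left (pi/2). norm (F x) \<le> K * cos x powr r"
    using assms(2) by (intro eventually_at_leftI[of 0]) auto
  have "\<forall>\<^sub>F x in at_left (pi/2). 0 \<le> cos x"
    using cos_gt_zero by (intro eventually_at_leftI[of 0]) (auto intro: less_imp_le)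
  then have "((\<lambda>x. K * cos x powr r) \<longlongrightarrow> K * 0) (at_left (pi/2))"
    using assms(1) by (intro tendsto_intros tendsto_zero_powrI tendsto_cos_at_left_half_pi) auto
  then show "((\<lambda>x. K * cos x powr r) \<longlongrightarrow> 0) (at_left (pi/2))" by simp
qed

text \<open>The derivative of exp(-w / cos x) cos^r x is -sin x (w cos^(r-2) x + r cos^(r-1) x)
  exp(-w / cos x), whence the two exponents. The boundary term at 0 vanishes by
  \<open>q 0 = 0\<close>, the one at pi/2 by exponential decay or, for w = 0, because r > 0.\<close>

lemma arc_laplace_by_parts:
  assumes q: "\<And>z. (q has_field_derivative q' z) (at z)" and q': "continuous_on UNIV q'" and q0: "q 0 = 0"
    and w: "Re w > 0 \<or> w = 0 \<and> r > 0"
  shows "arc_laplace r q' w =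
    w * arc_laplace (r - 2) (\<lambda>z. sin z * q z) w + of_real r * arc_laplace (r - 1) (\<lambda>z. sin z * q z) w"
proof -
  define E where "E r x = exp (- w / of_real (cos x)) * complex_of_real (cos x powr r)" for r x
  have qc: "continuous_on UNIV q"
    using q by (auto intro: DERIV_isCont continuous_at_imp_continuous_on)
  have sqc: "continuous_on UNIV (\<lambda>z. sin z * q z)" by (intro continuous_intros qc)
  define f where "f x = E r x * q' (of_real x) - w * (E (r - 2) x * (sin (of_real x) * q (of_real x)))
     - of_real r * (E (r - 1) x * (sin (of_real x) * q (of_real x)))" for x :: real
  have i1: "integrable quarter (\<lambda>x. E r x * q' (of_real x))"
    unfolding E_def using w by (intro integrable_arc_laplace q') auto
  \<comment> \<open>At w = 0 the integral with exponent r - 2 can diverge, but it occurs only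
    multiplied by w; hence the separate case.\<close>
  have i2: "integrable quarter (\<lambda>x. w * (E (r - 2) x * (sin (of_real x) * q (of_real x))))"
  proof (cases "w = 0")
    case False
    then show ?thesis using w unfolding E_def
      by (intro integrable_mult_right integrable_arc_laplace[OF sqc]) auto
  qed simp
  have i3: "integrable quarter (\<lambda>x. of_real r * (E (r - 1) x * (sin (of_real x) * q (of_real x))))"
    unfolding E_def using w by (intro integrable_mult_right integrable_arc_laplace[OF sqc]) auto
  have "integral\<^sup>L quarter f = 0 - 0"
  proof (rule integral_quarter_FTC)
    show "integrable quarter f" unfolding f_def using i1 i2 i3 by (intro Bochner_Integration.integrable_diff)
    show "continuous_on {0<..<pi/2} f" unfolding f_def E_def
      by (intro continuous_on_diff continuous_on_mult_left continuous_arc_integrand q' sqc)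
    show "((\<lambda>x. E r x * q (of_real x)) has_vector_derivative f x) (at x)" if x: "x \<in> {0<..<pi/2}" for x
    proof -
      have c: "cos x > 0" using x by (simp add: cos_gt_zero)
      \<comment> \<open>The primitive is differentiated as a holomorphic function near the real
        point, where cos z is a positive real, and then restricted to the real line.\<close>
      define T where "T z = exp (- w / cos z) * (cos z powr complex_of_real r) * q z" for z
      have cz: "cos (complex_of_real x) = of_real (cos x)" by (simp add: cos_of_real)
      have pw: "complex_of_real (cos x) powr of_real s = of_real (cos x powr s)" for s
        using c by (simp add: powr_of_real)
      have p1: "of_real (cos x powr (r - 1)) = of_real (cos x powr r) / (of_real (cos x) :: complex)"
        and p2: "of_real (cos x powr (r - 2)) = of_real (cos x powr r) / (of_real (cos x) :: complex)\<^sup>2"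
        using c by (simp_all add: powr_diff powr_numeral)
      have "((\<lambda>z. exp (- w / cos z)) has_field_derivative
          exp (- w / cos (of_real x)) * (- (w * sin (of_real x)) / (cos (of_real x))\<^sup>2)) (at (of_real x))"
        using c by (auto intro!: derivative_eq_intros simp: cz power2_eq_square)
      moreover have "((\<lambda>z. cos z powr complex_of_real r) has_field_derivative
          of_real r * cos (of_real x) powr (of_real r - 1) * - sin (of_real x)) (at (of_real x))"
        using c by (auto intro!: derivative_eq_intros simp: cz)
      ultimately have "(T has_field_derivative
          (exp (- w / cos (of_real x)) * (- (w * sin (of_real x)) / (cos (of_real x))\<^sup>2) * (cos (of_real x) powr of_real r)
         + (of_real r * cos (of_real x) powr (of_real r - 1) * - sin (of_real x)) * exp (- w / cos (of_real x))) * q (of_real x)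
         + q' (of_real x) * (exp (- w / cos (of_real x)) * (cos (of_real x) powr of_real r))) (at (of_real x))"
        unfolding T_def[abs_def] by (intro DERIV_mult q)
      also have "(exp (- w / cos (of_real x)) * (- (w * sin (of_real x)) / (cos (of_real x))\<^sup>2) * (cos (of_real x) powr of_real r)
         + (of_real r * cos (of_real x) powr (of_real r - 1) * - sin (of_real x)) * exp (- w / cos (of_real x))) * q (of_real x)
         + q' (of_real x) * (exp (- w / cos (of_real x)) * (cos (of_real x) powr of_real r)) = f x"
        using pw[of r] pw[of "r - 1"] unfolding cz f_def E_def
        by (simp add: p1 p2 algebra_simps)
      finally have "((\<lambda>x. T (of_real x)) has_vector_derivative f x) (at x)"
        by (rule has_vector_derivative_real_field)
      then show ?thesis
      proof (rule has_vector_derivative_transform_within_open)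
        show "T (of_real y) = E r y * q (of_real y)" if "y \<in> {0<..<pi/2}" for y
          using cos_gt_zero[of y] that unfolding T_def E_def by (simp add: cos_of_real powr_of_real)
      qed (use x in auto)
    qed
    obtain B where B: "B \<ge> 0" "\<And>x. x \<in> {0<..<pi/2} \<Longrightarrow> norm (q (of_real x)) \<le> B"
      using bounded_on_quarter[OF qc] by auto
    have nE: "norm (E r x) = exp (- Re w / cos x) * cos x powr r" for r x
      unfolding E_def norm_mult norm_exp_arc by simp
    show "((\<lambda>x. E r x * q (of_real x)) \<longlongrightarrow> 0) (at_left (pi/2))"
    proof (cases "Re w > 0")
      case True
      \<comment> \<open>One power of cos x is held back: a bound with exponent r - 1 leaves a factor
        cos x, which tends to 0.\<close>
      then obtain K where K: "K \<ge> 0" "\<And>c. 0 < c \<Longrightarrow> c \<le> 1 \<Longrightarrow> exp (- Re w / c) * c powr (r - 1) \<le> K"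
        using exp_powr_bound by metis
      show ?thesis
      proof (rule tendsto_zero_cos_powr_bound[of 1 _ "K * B"])
        fix x :: real assume x: "x \<in> {0<..<pi/2}"
        then have c: "cos x > 0" by (simp add: cos_gt_zero)
        have "norm (E r x * q (of_real x)) = (exp (- Re w / cos x) * cos x powr (r - 1)) * norm (q (of_real x)) * cos x"
          using c by (simp add: norm_mult nE powr_diff)
        also have "\<dots> \<le> K * B * cos x"
          using K(2)[OF c] K(1) B(2)[OF x] c by (intro mult_right_mono mult_mono) auto
        finally show "norm (E r x * q (of_real x)) \<le> K * B * cos x powr 1" using c by simp
      qed simp
    next
      case False
      then have "w = 0" "r > 0" using w by auto
      show ?thesis
      proof (rule tendsto_zero_cos_powr_bound[of r _ B])
        fix x :: real assume x: "x \<in> {0<..<pi/2}"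
        show "norm (E r x * q (of_real x)) \<le> B * cos x powr r"
          using B(2)[OF x] \<open>w = 0\<close> by (simp add: norm_mult nE mult.commute mult_right_mono)
      qed fact
    qed
    have "((\<lambda>x. E r x * q (of_real x)) \<longlongrightarrow> E r 0 * q (of_real 0)) (at_right 0)"
    proof (rule tendsto_mult)
      have "isCont (\<lambda>x. q (of_real x)) (0::real)"
        by (rule isCont_o2[where g = q]) (auto intro: DERIV_isCont[OF q] continuous_of_real)
      then show "((\<lambda>x. q (of_real x)) \<longlongrightarrow> q (of_real 0)) (at_right (0::real))"
        by (auto simp: isCont_def filterlim_at_split)
      have "isCont (E r) 0" unfolding E_def[abs_def]
        by (intro continuous_intros continuous_of_real) auto
      then show "(E r \<longlongrightarrow> E r 0) (at_right 0)" by (auto simp: isCont_def filterlim_at_split)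
    qed
    then show "((\<lambda>x. E r x * q (of_real x)) \<longlongrightarrow> 0) (at_right 0)" by (simp add: q0)
  qed
  also have "integral\<^sup>L quarter f = arc_laplace r q' w - w * arc_laplace (r - 2) (\<lambda>z. sin z * q z) w
       - of_real r * arc_laplace (r - 1) (\<lambda>z. sin z * q z) w"
    unfolding f_def using i1 i2 i3
    by (simp add: Bochner_Integration.integral_diff arc_laplace_def E_def mult.assoc)
  finally show ?thesis by (simp add: algebra_simps)
qed

section \<open>Behaviour at the origin\<close>

text \<open>For real z the argument z^2/2 is nonnegative, so the exponential has modulus at most 1
  and B cos^r x dominates uniformly in z; r > -1 makes this bound integrable.\<close>

lemma tendsto_arc_laplace_at_0:
  assumes g: "continuous_on UNIV g" and r: "r > -1"
  shows "((\<lambda>z. arc_laplace r g ((of_real z)\<^sup>2 / 2)) \<longlongrightarrow> arc_laplace r g 0) (at_right (0::real))"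
proof (rule tendsto_at_right_sequentially[of 0 1])
  fix S :: "nat \<Rightarrow> real" assume S: "\<And>n. 0 < S n" "S \<longlonglongrightarrow> 0"
  define w where "w n = (complex_of_real (S n))\<^sup>2 / 2" for n
  have w: "w \<longlonglongrightarrow> 0"
    unfolding w_def by (rule tendsto_eq_intros S(2) refl | simp)+
  have Re_w: "Re (w n) \<ge> 0" for n
    by (simp add: w_def flip: of_real_power)
  obtain B where B: "B \<ge> 0" "\<And>x. x \<in> {0<..<pi/2} \<Longrightarrow> norm (g (of_real x)) \<le> B"
    using bounded_on_quarter[OF g] by auto
  have "(\<lambda>n. arc_laplace r g (w n)) \<longlonglongrightarrow> arc_laplace r g 0"
    unfolding arc_laplace_def
  proof (rule integral_dominated_convergence)
    show "(\<lambda>x. exp (- 0 / of_real (cos x)) * of_real (cos x powr r) * g (of_real x)) \<in> borel_measurable quarter"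
      by (intro borel_measurable_quarter continuous_arc_integrand g)
    show "(\<lambda>x. exp (- w n / of_real (cos x)) * of_real (cos x powr r) * g (of_real x)) \<in> borel_measurable quarter" for n
      by (intro borel_measurable_quarter continuous_arc_integrand g)
    show "integrable quarter (\<lambda>x. B * cos x powr r)"
      using integrable_cos_powr[OF r] by simp
    have "(\<lambda>n. exp (- w n / of_real (cos x)) * of_real (cos x powr r) * g (of_real x))
        \<longlonglongrightarrow> exp (- 0 / of_real (cos x)) * of_real (cos x powr r) * g (of_real x)" if "cos x > 0" for x
      using that by (intro tendsto_intros w) auto
    then show "AE x in quarter. (\<lambda>n. exp (- w n / of_real (cos x)) * of_real (cos x powr r) * g (of_real x))
        \<longlonglongrightarrow> exp (- 0 / of_real (cos x)) * of_real (cos x powr r) * g (of_real x)"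
      by (intro AE_I2) (auto simp: cos_gt_zero)
    have "norm (exp (- w n / of_real (cos x)) * of_real (cos x powr r) * g (of_real x)) \<le> B * cos x powr r"
      if x: "x \<in> {0<..<pi/2}" for x n
    proof -
      have "cos x > 0" using x by (simp add: cos_gt_zero)
      then have "exp (- Re (w n) / cos x) \<le> 1" using Re_w[of n] by simp
      then have "exp (- Re (w n) / cos x) * cos x powr r * norm (g (of_real x)) \<le> 1 * cos x powr r * B"
        using B(2)[OF x] by (intro mult_mono mult_right_mono) auto
      then show ?thesis by (simp add: norm_mult norm_exp_arc mult.commute)
    qed
    then show "AE x in quarter. norm (exp (- w n / of_real (cos x)) * of_real (cos x powr r) * g (of_real x)) \<le> B * cos x powr r" for n
      by (intro AE_I2) auto
  qed
  then show "(\<lambda>n. arc_laplace r g ((of_real (S n))\<^sup>2 / 2)) \<longlonglongrightarrow> arc_laplace r g 0"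
    by (simp add: w_def)
qed simp

text \<open>This is (sqrt pi / 2) erf, the primitive that evaluates the integral with exponent -3/2
  and amplitude sin.\<close>

lemma gaussian_primitive:
  obtains Q :: "real \<Rightarrow> real" where
    "\<And>x. x > 0 \<Longrightarrow> (Q has_real_derivative exp (- x\<^sup>2)) (at x)"
    "(Q \<longlongrightarrow> 0) (at_right 0)" "(Q \<longlongrightarrow> sqrt pi / 2) at_top"
proof -
  define Q where "Q x = integral {0..x} (\<lambda>v. exp (- v\<^sup>2))" for x :: real
  have d: "(Q has_real_derivative exp (- x\<^sup>2)) (at x within {0..b})" if "0 \<le> x" "x \<le> b" for x b
    unfolding Q_def[abs_def] using that by (intro integral_has_real_derivative continuous_intros) auto
  show ?thesis
  proof (rule that)
    show "(Q has_real_derivative exp (- x\<^sup>2)) (at x)" if "x > 0" for x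
      using d[of x "x + 1"] that by (simp add: at_within_Icc_at)
    have "(Q \<longlongrightarrow> Q 0) (at 0 within {0..1})"
      using DERIV_continuous[OF d[of 0 1]] by (simp add: continuous_within)
    then show "(Q \<longlongrightarrow> 0) (at_right 0)"
      by (simp add: at_within_Icc_at_right Q_def)
    have i: "integrable lborel (\<lambda>x::real. indicator {0..} x *\<^sub>R exp (- x\<^sup>2))"
      using gaussian_moment_0 by (rule integrable.intros)
    have v: "integral\<^sup>L lborel (\<lambda>x::real. indicator {0..} x *\<^sub>R exp (- x\<^sup>2)) = sqrt pi / 2"
      using gaussian_moment_0 by (rule has_bochner_integral_integral_eq)
    have "((\<lambda>y. integral\<^sup>L lborel (\<lambda>x::real. indicator {..y} x *\<^sub>R (indicator {0..} x *\<^sub>R exp (- x\<^sup>2)))) \<longlongrightarrow> sqrt pi / 2) at_top"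
      using tendsto_integral_at_top[OF sets_lborel i] unfolding v .
    moreover have "(\<integral>x. indicator {..y} x *\<^sub>R (indicator {0..} x *\<^sub>R exp (- x\<^sup>2)) \<partial>lborel) = Q y" for y
    proof -
      have "(\<integral>x. indicator {..y} x *\<^sub>R (indicator {0..} x *\<^sub>R exp (- x\<^sup>2)) \<partial>lborel) = (LBINT x:{0..y}. exp (- x\<^sup>2))"
        unfolding set_lebesgue_integral_def by (intro Bochner_Integration.integral_cong) (auto simp: indicator_def)
      also have "\<dots> = Q y"
        unfolding Q_def by (intro set_borel_integral_eq_integral borel_integrable_atLeastAtMost' continuous_intros)
      finally show ?thesis .
    qed
    ultimately show "(Q \<longlongrightarrow> sqrt pi / 2) at_top" by simp
  qed
qed

text \<open>For the amplitude sin the substitution u = z / sqrt(2 cos x) is exact: z cos^(-3/2) x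
  sin x dx = 2 sqrt 2 du and z^2 / (2 cos x) = u^2. So z times the integral is 2 sqrt 2 times a
  Gaussian integral from z / sqrt 2 to infinity, which fills the half-line as z tends to 0.\<close>

lemma tendsto_arc_laplace_sin:
  "((\<lambda>z. of_real z * arc_laplace (- 3 / 2) sin ((of_real z)\<^sup>2 / 2)) \<longlongrightarrow> of_real (sqrt (2 * pi))) (at_right (0::real))"
proof -
  obtain Q where Q: "\<And>x. x > 0 \<Longrightarrow> (Q has_real_derivative exp (- x\<^sup>2)) (at x)"
    "(Q \<longlongrightarrow> 0) (at_right 0)" "(Q \<longlongrightarrow> sqrt pi / 2) at_top"
    using gaussian_primitive by auto
  have eq: "of_real z * arc_laplace (- 3 / 2) sin ((of_real z)\<^sup>2 / 2)
      = complex_of_real (2 * sqrt 2 * (sqrt pi / 2)) - of_real (2 * sqrt 2 * Q (z / sqrt 2))" if z: "z > 0" for z :: real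
  proof -
    define f where "f x = of_real z * (exp (- ((complex_of_real z)\<^sup>2 / 2) / of_real (cos x)) *
      of_real (cos x powr (- 3 / 2)) * sin (of_real x))" for x
    define u where "u x = z / sqrt 2 * cos x powr (- 1 / 2)" for x
    have cs: "continuous_on UNIV (sin :: complex \<Rightarrow> complex)" by (intro continuous_intros)
    have "integral\<^sup>L quarter f = complex_of_real (2 * sqrt 2 * (sqrt pi / 2)) - of_real (2 * sqrt 2 * Q (z / sqrt 2))"
    proof (rule integral_quarter_FTC)
      show "continuous_on {0<..<pi/2} f"
        unfolding f_def by (intro continuous_on_mult_left continuous_arc_integrand cs)
      show "integrable quarter f"
        unfolding f_def using z by (intro integrable_mult_right integrable_arc_laplace cs) (simp flip: of_real_power)
      show "((\<lambda>x. complex_of_real (2 * sqrt 2 * Q (u x))) has_vector_derivative f x) (at x)"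
        if x: "x \<in> {0<..<pi/2}" for x
      proof -
        have c: "cos x > 0" using x by (simp add: cos_gt_zero)
        then have "u x > 0" using z by (simp add: u_def)
        have du: "(u has_real_derivative z / sqrt 2 * (- 1 / 2 * cos x powr (- 3 / 2) * - sin x)) (at x)"
          unfolding u_def[abs_def] using DERIV_fun_powr[OF DERIV_cos c, of "- 1 / 2"]
          by (intro DERIV_cmult) simp
        have u2: "(u x)\<^sup>2 = z\<^sup>2 / 2 / cos x"
          using c by (simp add: u_def power_mult_distrib power_divide powr_power powr_minus_divide)
        have "((\<lambda>x. 2 * sqrt 2 * Q (u x)) has_real_derivative
            2 * sqrt 2 * (exp (- (u x)\<^sup>2) * (z / sqrt 2 * (- 1 / 2 * cos x powr (- 3 / 2) * - sin x)))) (at x)"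
          by (intro DERIV_cmult DERIV_chain2[OF Q(1)[OF \<open>u x > 0\<close>] du])
        also have "2 * sqrt 2 * (exp (- (u x)\<^sup>2) * (z / sqrt 2 * (- 1 / 2 * cos x powr (- 3 / 2) * - sin x)))
            = z * (exp (- (z\<^sup>2 / 2) / cos x) * cos x powr (- 3 / 2) * sin x)"
          unfolding u2 by simp
        finally have "((\<lambda>x. complex_of_real (2 * sqrt 2 * Q (u x))) has_vector_derivative
            of_real (z * (exp (- (z\<^sup>2 / 2) / cos x) * cos x powr (- 3 / 2) * sin x))) (at x)"
          by (intro has_vector_derivative_of_real) (simp add: has_real_derivative_iff_has_vector_derivative)
        also have "complex_of_real (z * (exp (- (z\<^sup>2 / 2) / cos x) * cos x powr (- 3 / 2) * sin x)) = f x"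
          by (simp add: f_def sin_of_real exp_of_real flip: of_real_power of_real_divide of_real_minus of_real_mult)
             (simp add: sin_of_real flip: exp_of_real)
        finally show ?thesis .
      qed
      have "isCont u 0" unfolding u_def[abs_def] by (intro continuous_intros) auto
      then have "(u \<longlongrightarrow> z / sqrt 2) (at_right 0)"
        by (auto simp: isCont_def filterlim_at_split u_def)
      moreover have "isCont Q (z / sqrt 2)" using Q(1)[of "z / sqrt 2"] z by (intro DERIV_isCont) auto
      ultimately have "((\<lambda>x. Q (u x)) \<longlongrightarrow> Q (z / sqrt 2)) (at_right 0)"
        by (rule isCont_tendsto_compose[rotated])
      then show "((\<lambda>x. complex_of_real (2 * sqrt 2 * Q (u x))) \<longlongrightarrow> of_real (2 * sqrt 2 * Q (z / sqrt 2))) (at_right 0)"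
        by (intro tendsto_intros)
      have "filterlim (\<lambda>x. cos x powr (- 1 / 2)) at_top (at_left (pi/2))"
      proof -
        have "filterlim (\<lambda>c::real. c powr (- 1 / 2)) at_top (at_right 0)" by real_asymp
        then show ?thesis by (rule filterlim_compose[OF _ filterlim_cos_at_left_half_pi])
      qed
      then have "filterlim u at_top (at_left (pi/2))"
        unfolding u_def[abs_def] using z by (intro filterlim_tendsto_pos_mult_at_top[OF tendsto_const]) auto
      then have "((\<lambda>x. Q (u x)) \<longlongrightarrow> sqrt pi / 2) (at_left (pi/2))"
        by (rule filterlim_compose[OF Q(3)])
      then show "((\<lambda>x. complex_of_real (2 * sqrt 2 * Q (u x))) \<longlongrightarrow> complex_of_real (2 * sqrt 2 * (sqrt pi / 2))) (at_left (pi/2))"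
        by (intro tendsto_intros)
    qed
    moreover have "integral\<^sup>L quarter f = of_real z * arc_laplace (- 3 / 2) sin ((of_real z)\<^sup>2 / 2)"
      unfolding f_def[abs_def] arc_laplace_def by (rule integral_mult_right_zero)
    ultimately show ?thesis by (metis (no_types))
  qed
  have "((\<lambda>z. z / sqrt 2) \<longlongrightarrow> 0) (at_right (0::real))" by (auto intro!: tendsto_eq_intros)
  then have "filterlim (\<lambda>z. z / sqrt 2) (at_right 0) (at_right (0::real))"
    by (auto simp: filterlim_at eventually_at_filter)
  then have "((\<lambda>z. Q (z / sqrt 2)) \<longlongrightarrow> 0) (at_right 0)" by (rule filterlim_compose[OF Q(2)])
  then have "((\<lambda>z. complex_of_real (2 * sqrt 2 * (sqrt pi / 2)) - of_real (2 * sqrt 2 * Q (z / sqrt 2)))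
      \<longlongrightarrow> complex_of_real (2 * sqrt 2 * (sqrt pi / 2)) - of_real (2 * sqrt 2 * 0)) (at_right 0)"
    by (intro tendsto_intros)
  also have "complex_of_real (2 * sqrt 2 * (sqrt pi / 2)) - of_real (2 * sqrt 2 * 0) = of_real (sqrt (2 * pi))"
    by (simp add: real_sqrt_mult)
  finally show ?thesis
  proof (rule Lim_transform_eventually)
    show "\<forall>\<^sub>F z in at_right 0. complex_of_real (2 * sqrt 2 * (sqrt pi / 2)) - of_real (2 * sqrt 2 * Q (z / sqrt 2))
      = of_real z * arc_laplace (- 3 / 2) sin ((of_real z)\<^sup>2 / 2)"
      using eq[symmetric] by (intro eventually_at_rightI[of 0 1]) auto
  qed
qed

text \<open>For \<open>r = -3/2\<close> the integral diverges like \<open>1/z\<close> as \<open>z \<rightarrow> 0\<close>, and only the value of \<open>q\<close> at \<open>\<pi>/2\<close>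
  contributes to the limit.\<close>

lemma tendsto_arc_laplace_critical:
  assumes q: "\<And>z. (q has_field_derivative q' z) (at z)" and q': "continuous_on UNIV q'"
  shows "((\<lambda>z. of_real z * arc_laplace (- 3 / 2) q ((of_real z)\<^sup>2 / 2)) \<longlongrightarrow> q (of_real (pi/2)) * of_real (sqrt (2 * pi)))
    (at_right (0::real))"
proof -
  define k where "k = q (of_real (pi/2))"
  \<comment> \<open>Subtracting the multiple of sin with the same value at pi/2 makes
    \<open>m\<close> vanish there. The zero gains one power of cos x, so the integral with exponent
    -3/2 is controlled by the convergent one with exponent -1/2.\<close>
  define m where "m z = q z - k * sin z" for z
  have qc: "continuous_on UNIV q"
    using q by (auto intro: DERIV_isCont continuous_at_imp_continuous_on)
  have sc: "continuous_on UNIV (\<lambda>z::complex. k * sin z)" by (intro continuous_intros)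
  have mc: "continuous_on UNIV m" unfolding m_def by (intro continuous_intros qc)
  have dm: "(m has_field_derivative q' z - k * cos z) (at z)" for z
    unfolding m_def[abs_def] by (auto intro!: derivative_eq_intros q)
  have "continuous_on UNIV (\<lambda>z. q' z - k * cos z)" by (intro continuous_intros q')
  \<comment> \<open>The disc of radius 2 contains the segment from 0 to pi/2, where the mean value
    inequality is applied.\<close>
  then have "bounded ((\<lambda>z. q' z - k * cos z) ` cball 0 2)"
    by (intro compact_imp_bounded compact_continuous_image) (auto intro: continuous_on_subset)
  then obtain B where B: "\<And>z. norm z \<le> 2 \<Longrightarrow> norm (q' z - k * cos z) \<le> B"
    by (force simp: bounded_iff)
  have B0: "B \<ge> 0" using order_trans[OF norm_ge_zero B[of 0]] by simp
  have m_le: "norm (m (of_real x)) \<le> 2 * B * cos x" if x: "x \<in> {0<..<pi/2}" for x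
  proof -
    have "norm (m (of_real x) - m (of_real (pi/2))) \<le> B * norm (complex_of_real x - of_real (pi/2))"
    proof (rule field_differentiable_bound[of "cball 0 2"])
      show "(m has_field_derivative q' z - k * cos z) (at z within cball 0 2)" for z
        by (rule has_field_derivative_at_within) (rule dm)
    qed (use x B pi_less_4 in auto)
    also have "norm (complex_of_real x - of_real (pi/2)) = pi/2 - x"
      unfolding of_real_diff[symmetric] norm_of_real using x by simp
    also have "m (of_real (pi/2)) = 0"
      by (simp add: m_def k_def sin_of_real flip: of_real_divide)
    also have "B * (pi/2 - x) \<le> B * (2 * cos x)"
      using cos_ge_linear[of x] x B0 by (intro mult_left_mono) auto
    finally show ?thesis by (simp add: mult.commute mult.left_commute)
  qed
  \<comment> \<open>This bound is independent of z, so z times the integral of \<open>m\<close>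
    tends to 0 and only the multiple of sin survives.\<close>
  define I where "I = (\<integral>x. 2 * B * cos x powr (- 1 / 2) \<partial>quarter)"
  have bound: "norm (arc_laplace (- 3 / 2) m ((of_real z)\<^sup>2 / 2)) \<le> I" if z: "z > 0" for z :: real
    unfolding arc_laplace_def I_def
  proof (rule order_trans[OF integral_norm_bound integral_mono])
    have Re_z: "Re ((complex_of_real z)\<^sup>2 / 2) > 0" using z by (simp flip: of_real_power)
    then show "integrable quarter (\<lambda>x. norm (exp (- ((complex_of_real z)\<^sup>2 / 2) / of_real (cos x)) *
        of_real (cos x powr (- 3 / 2)) * m (of_real x)))"
      by (intro integrable_norm integrable_arc_laplace mc) auto
    show "integrable quarter (\<lambda>x. 2 * B * cos x powr (- 1 / 2))"
      by (intro integrable_mult_right integrable_cos_powr) auto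
    fix x assume "x \<in> space quarter"
    then have x: "x \<in> {0<..<pi/2}" by simp
    then have c: "cos x > 0" by (simp add: cos_gt_zero)
    have "exp (- Re ((complex_of_real z)\<^sup>2 / 2) / cos x) * cos x powr (- 3 / 2) * norm (m (of_real x))
        \<le> 1 * cos x powr (- 3 / 2) * (2 * B * cos x)"
      using Re_z c m_le[OF x] by (intro mult_mono mult_right_mono) auto
    also have "\<dots> = 2 * B * (cos x powr (- 3 / 2) * cos x powr 1)" using c by simp
    also have "cos x powr (- 3 / 2) * cos x powr 1 = cos x powr (- 1 / 2)"
      unfolding powr_add[symmetric] by simp
    finally show "norm (exp (- ((complex_of_real z)\<^sup>2 / 2) / of_real (cos x)) *
        of_real (cos x powr (- 3 / 2)) * m (of_real x)) \<le> 2 * B * cos x powr (- 1 / 2)"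
      unfolding norm_mult norm_exp_arc by simp
  qed
  have lim: "((\<lambda>z. of_real z * arc_laplace (- 3 / 2) m ((of_real z)\<^sup>2 / 2)) \<longlongrightarrow> 0) (at_right (0::real))"
  proof (rule Lim_null_comparison)
    show "\<forall>\<^sub>F z in at_right 0. norm (of_real z * arc_laplace (- 3 / 2) m ((of_real z)\<^sup>2 / 2)) \<le> z * I"
      using bound by (intro eventually_at_rightI[of 0 1]) (auto simp: norm_mult intro!: mult_mono)
    show "((\<lambda>z. z * I) \<longlongrightarrow> 0) (at_right 0)" by (auto intro!: tendsto_eq_intros)
  qed
  have split: "arc_laplace (- 3 / 2) q ((of_real z)\<^sup>2 / 2)
      = arc_laplace (- 3 / 2) m ((of_real z)\<^sup>2 / 2) + k * arc_laplace (- 3 / 2) sin ((of_real z)\<^sup>2 / 2)"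
    if "z > 0" for z :: real
  proof -
    have "Re ((complex_of_real z)\<^sup>2 / 2) > 0" using that by (simp flip: of_real_power)
    then have "arc_laplace (- 3 / 2) (\<lambda>x. m x + k * sin x) ((of_real z)\<^sup>2 / 2) = arc_laplace (- 3 / 2) m ((of_real z)\<^sup>2 / 2)
       + arc_laplace (- 3 / 2) (\<lambda>x. k * sin x) ((of_real z)\<^sup>2 / 2)"
      by (intro arc_laplace_add mc sc) auto
    then show ?thesis by (simp add: m_def arc_laplace_mult)
  qed
  have "((\<lambda>z. of_real z * arc_laplace (- 3 / 2) m ((of_real z)\<^sup>2 / 2)
      + k * (of_real z * arc_laplace (- 3 / 2) sin ((of_real z)\<^sup>2 / 2))) \<longlongrightarrow> 0 + k * of_real (sqrt (2 * pi))) (at_right (0::real))"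
    by (intro tendsto_intros lim tendsto_arc_laplace_sin)
  then have "((\<lambda>z. of_real z * arc_laplace (- 3 / 2) m ((of_real z)\<^sup>2 / 2)
      + k * (of_real z * arc_laplace (- 3 / 2) sin ((of_real z)\<^sup>2 / 2))) \<longlongrightarrow> q (of_real (pi/2)) * of_real (sqrt (2 * pi))) (at_right (0::real))"
    by (simp add: k_def)
  then show ?thesis
  proof (rule Lim_transform_eventually)
    have "of_real z * arc_laplace (- 3 / 2) m ((of_real z)\<^sup>2 / 2)
      + k * (of_real z * arc_laplace (- 3 / 2) sin ((of_real z)\<^sup>2 / 2))
      = of_real z * arc_laplace (- 3 / 2) q ((of_real z)\<^sup>2 / 2)" if "z > 0" for z :: real
      unfolding split[OF that] by (simp only: distrib_left mult.left_commute)
    then show "\<forall>\<^sub>F z in at_right 0. of_real z * arc_laplace (- 3 / 2) m ((of_real z)\<^sup>2 / 2)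
      + k * (of_real z * arc_laplace (- 3 / 2) sin ((of_real z)\<^sup>2 / 2))
      = of_real z * arc_laplace (- 3 / 2) q ((of_real z)\<^sup>2 / 2)"
      by (intro eventually_at_rightI[of 0 1]) auto
  qed
qed

section \<open>Cauchy's cosine integral\<close>

text \<open>Two integrations by parts at w = 0, with q = sin(\<alpha> z) at exponent s + 1 and q =
  sin z cos(\<alpha> z) at exponent s, both involve the auxiliary integral \<open>X\<close>;
  eliminating it leaves a relation between exponents s - 1 and s + 1. Positivity of s kills the
  boundary terms.\<close>

lemma arc_laplace_0_recurrence:
  fixes \<alpha> :: complex
  assumes s: "s > 0"
  shows "((of_real s + 1)\<^sup>2 - \<alpha>\<^sup>2) * arc_laplace (s + 1) (\<lambda>z. cos (\<alpha> * z)) 0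
    = of_real s * (of_real s + 1) * arc_laplace (s - 1) (\<lambda>z. cos (\<alpha> * z)) 0"
proof -
  define J where "J r = arc_laplace r (\<lambda>z. cos (\<alpha> * z)) 0" for r
  define X where "X = arc_laplace s (\<lambda>z. sin z * sin (\<alpha> * z)) 0"
  have c: "continuous_on UNIV (\<lambda>z. cos (\<alpha> * z))"
    "continuous_on UNIV (\<lambda>z. cos z * cos (\<alpha> * z))"
    "continuous_on UNIV (\<lambda>z. (- \<alpha>) * (sin z * sin (\<alpha> * z)))"
    "continuous_on UNIV (\<lambda>z. \<alpha> * cos (\<alpha> * z))"
    by (intro continuous_intros)+
  have "arc_laplace (s + 1) (\<lambda>z. \<alpha> * cos (\<alpha> * z)) 0 =
      0 * arc_laplace (s + 1 - 2) (\<lambda>z. sin z * sin (\<alpha> * z)) 0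
      + of_real (s + 1) * arc_laplace (s + 1 - 1) (\<lambda>z. sin z * sin (\<alpha> * z)) 0"
    by (rule arc_laplace_by_parts[OF _ c(4)]) (use s in \<open>auto intro!: derivative_eq_intros\<close>)
  then have 1: "\<alpha> * J (s + 1) = (of_real s + 1) * X"
    by (simp add: arc_laplace_mult J_def X_def)
  have "arc_laplace s (\<lambda>z. cos z * cos (\<alpha> * z) + (- \<alpha>) * (sin z * sin (\<alpha> * z))) 0
      = 0 * arc_laplace (s - 2) (\<lambda>z. sin z * (sin z * cos (\<alpha> * z))) 0
      + of_real s * arc_laplace (s - 1) (\<lambda>z. sin z * (sin z * cos (\<alpha> * z))) 0"
    by (rule arc_laplace_by_parts)
      (use s in \<open>auto intro!: derivative_eq_intros continuous_intros simp: algebra_simps\<close>)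
  moreover have "arc_laplace s (\<lambda>z. cos z * cos (\<alpha> * z) + (- \<alpha>) * (sin z * sin (\<alpha> * z))) 0
      = J (s + 1) - \<alpha> * X"
  proof -
    have "arc_laplace s (\<lambda>z. cos z * cos (\<alpha> * z) + (- \<alpha>) * (sin z * sin (\<alpha> * z))) 0
        = J (s + 1) + (- \<alpha>) * X"
      unfolding J_def X_def arc_laplace_mult[symmetric] arc_laplace_cos_mult[symmetric]
      by (rule arc_laplace_add[OF c(2,3)]) (use s in auto)
    then show ?thesis by simp
  qed
  moreover have "arc_laplace (s - 1) (\<lambda>z. sin z * (sin z * cos (\<alpha> * z))) 0 = J (s - 1) - J (s + 1)"
    using s by (subst arc_laplace_sin_squared_mult[OF c(1)]) (auto simp: J_def add.commute)
  ultimately have 2: "J (s + 1) - \<alpha> * X = of_real s * (J (s - 1) - J (s + 1))" by simp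
  have "((of_real s + 1)\<^sup>2 - \<alpha>\<^sup>2) * J (s + 1) = (of_real s + 1) * ((of_real s + 1) * J (s + 1) - \<alpha> * X)"
    using 1 by (simp add: algebra_simps power2_eq_square)
  also have "\<dots> = of_real s * (of_real s + 1) * J (s - 1)"
    using 2 by (simp add: algebra_simps)
  finally show ?thesis by (simp add: J_def)
qed

lemma arc_laplace_0_1: "arc_laplace r (\<lambda>z. 1) 0 = of_real (\<integral>x. cos x powr r \<partial>quarter)"
  unfolding arc_laplace_def by simp

text \<open>Strict positivity licenses division by the case \<alpha> = 0. A nonnegative integrand
  with zero integral would vanish almost everywhere on a space of measure pi/2.\<close>

lemma integral_cos_powr_pos:
  assumes "r > -1"
  shows "(\<integral>x. cos x powr r \<partial>quarter) > 0"
proof -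
  have "(\<integral>x. cos x powr r \<partial>quarter) \<noteq> 0"
  proof
    assume "(\<integral>x. cos x powr r \<partial>quarter) = 0"
    then have "AE x in quarter. cos x powr r = 0"
      using integral_nonneg_eq_0_iff_AE[OF integrable_cos_powr[OF assms]] by simp
    moreover have "AE x in quarter. cos x powr r \<noteq> 0"
      by (intro AE_I2) (auto dest: cos_gt_zero simp: less_imp_neq)
    ultimately have "AE x in quarter. False" by eventually_elim simp
    then have "space quarter \<in> null_sets quarter"
      by (subst AE_iff_null_sets[OF sets.top]) (auto elim: eventually_mono)
    then have "emeasure quarter (space quarter) = 0" by auto
    then show False by (simp add: quarter_def emeasure_restrict_space)
  qed
  moreover have "(\<integral>x. cos x powr r \<partial>quarter) \<ge> 0" by (intro Bochner_Integration.integral_nonneg) simp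
  ultimately show ?thesis by linarith
qed

text \<open>As the exponent grows, the weight cos^r x concentrates at x = 0, where cos(\<alpha> x) =
  1. Quantitatively |cos(\<alpha> x) - 1| \<le> K sin^2 x, and the weighted mean of sin^2 x is 1/(r
  + 2).\<close>

lemma arc_laplace_0_ratio:
  fixes \<alpha> :: complex
  assumes s: "s > 0"
  shows "(\<lambda>n. arc_laplace (s + 2 * real n - 1) (\<lambda>z. cos (\<alpha> * z)) 0 / arc_laplace (s + 2 * real n - 1) (\<lambda>z. 1) 0) \<longlonglongrightarrow> 1"
proof -
  define m where "m z = cos (\<alpha> * z) - 1" for z :: complex
  have c1: "continuous_on UNIV (\<lambda>z::complex. 1::complex)" and mc: "continuous_on UNIV m"
    unfolding m_def by (intro continuous_intros)+
  define P where "P r = (\<integral>x. cos x powr r \<partial>quarter)" for r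
  \<comment> \<open>Wallis's reduction formula, read off from the general recurrence at \<alpha> =
    0.\<close>
  have rec: "(r + 2) * P (r + 2) = (r + 1) * P r" if "r > -1" for r
  proof -
    have "(of_real (r + 1) + 1)\<^sup>2 * arc_laplace (r + 2) (\<lambda>z. 1) 0
        = of_real (r + 1) * (of_real (r + 1) + 1) * arc_laplace r (\<lambda>z. 1) 0"
      using arc_laplace_0_recurrence[of "r + 1" 0] that by (simp add: add.commute)
    then have "complex_of_real ((r + 2)\<^sup>2 * P (r + 2)) = of_real ((r + 1) * (r + 2) * P r)"
      unfolding arc_laplace_0_1 P_def by (simp add: add.commute)
    then have "(r + 2)\<^sup>2 * P (r + 2) = (r + 1) * (r + 2) * P r" by (simp only: of_real_eq_iff)
    then show ?thesis using that by (simp add: power2_eq_square)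
  qed
  have "bounded (cos ` cball (0::complex) (norm \<alpha>))"
    by (intro compact_imp_bounded compact_continuous_image continuous_intros) auto
  then obtain B where B: "\<And>z::complex. norm z \<le> norm \<alpha> \<Longrightarrow> norm (cos z) \<le> B"
    by (force simp: bounded_iff)
  have B0: "B \<ge> 0" using order_trans[OF norm_ge_zero B[of 0]] by simp
  \<comment> \<open>From cos(2 u) - 1 = -2 sin^2 u with u = \<alpha> x / 2: \<open>B\<close> is a
    Lipschitz constant of sin on the disc of radius |\<alpha>|, and x/2 \<le> sin x.\<close>
  define K where "K = 2 * (B * norm \<alpha>)\<^sup>2"
  have K: "norm (m (of_real x)) \<le> K * (1 - (cos x)\<^sup>2)" if x: "x \<in> {0<..<pi/2}" for x
  proof -
    define u where "u = \<alpha> * of_real x / 2"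
    have xs: "x / 2 \<le> sin x" using cos_ge_linear[of "pi/2 - x"] x by (simp add: cos_sin_eq)
    have "x \<le> 2" using x pi_less_4 by simp
    then have u: "norm u \<le> norm \<alpha>" using x mult_left_mono[of x 2 "norm \<alpha>"] by (simp add: u_def norm_mult norm_divide)
    have "norm (sin u - sin 0) \<le> B * norm (u - 0)"
    proof (rule field_differentiable_bound[of "cball 0 (norm \<alpha>)"])
      show "(sin has_field_derivative cos z) (at z within cball 0 (norm \<alpha>))" for z :: complex
        by (rule has_field_derivative_at_within) (rule DERIV_sin)
    qed (use u B in auto)
    also have "B * norm (u - 0) = B * norm \<alpha> * (x / 2)" using x by (simp add: u_def norm_mult norm_divide)
    also have "\<dots> \<le> B * norm \<alpha> * sin x" using xs B0 by (intro mult_left_mono) auto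
    finally have "(norm (sin u))\<^sup>2 \<le> (B * norm \<alpha> * sin x)\<^sup>2" by (intro power_mono) auto
    moreover have "m (of_real x) = - 2 * (sin u)\<^sup>2"
      using cos_double_sin[of u] by (simp add: m_def u_def)
    ultimately show ?thesis
      by (simp add: norm_mult norm_power K_def sin_squared_eq[symmetric] power_mult_distrib)
  qed
  have bound: "norm (arc_laplace r (\<lambda>z. cos (\<alpha> * z)) 0 / arc_laplace r (\<lambda>z. 1) 0 - 1) \<le> K / (r + 2)"
    if r: "r > -1" for r
  proof -
    have "arc_laplace r (\<lambda>z. 1 + m z) 0 = arc_laplace r (\<lambda>z. 1) 0 + arc_laplace r m 0"
      by (rule arc_laplace_add[OF c1 mc]) (use r in auto)
    then have split: "arc_laplace r (\<lambda>z. cos (\<alpha> * z)) 0 = of_real (P r) + arc_laplace r m 0"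
      by (simp add: m_def arc_laplace_0_1 P_def)
    have i2: "integrable quarter (\<lambda>x. cos x powr (r + 2))"
      using integrable_cos_powr[of "r + 2"] r by simp
    have "norm (arc_laplace r m 0) \<le> (\<integral>x. K * (cos x powr r - cos x powr (r + 2)) \<partial>quarter)"
      unfolding arc_laplace_def
    proof (rule order_trans[OF integral_norm_bound integral_mono])
      show "integrable quarter (\<lambda>x. norm (exp (- 0 / of_real (cos x)) * of_real (cos x powr r) * m (of_real x)))"
        by (intro integrable_norm integrable_arc_laplace mc) (use r in auto)
      show "integrable quarter (\<lambda>x. K * (cos x powr r - cos x powr (r + 2)))"
        using i2 integrable_cos_powr[OF r] by simp
      fix x assume "x \<in> space quarter"
      then have x: "x \<in> {0<..<pi/2}" by simp
      then have c: "cos x > 0" by (simp add: cos_gt_zero)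
      have "norm (exp (- 0 / of_real (cos x)) * of_real (cos x powr r) * m (of_real x)) = cos x powr r * norm (m (of_real x))"
        by (simp add: norm_mult)
      also have "\<dots> \<le> cos x powr r * (K * (1 - (cos x)\<^sup>2))" by (intro mult_left_mono K[OF x]) simp
      also have "\<dots> = K * (cos x powr r - cos x powr (r + 2))"
        using c by (simp add: powr_add powr_numeral algebra_simps)
      finally show "norm (exp (- 0 / of_real (cos x)) * of_real (cos x powr r) * m (of_real x))
          \<le> K * (cos x powr r - cos x powr (r + 2))" .
    qed
    also have "\<dots> = K * (P r - P (r + 2))"
      using i2 integrable_cos_powr[OF r] by (simp add: P_def)
    also have "P (r + 2) = (r + 1) / (r + 2) * P r" using rec[OF r] r by (simp add: field_simps)
    also have "K * (P r - (r + 1) / (r + 2) * P r) = K / (r + 2) * P r" using r by (simp add: field_simps)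
    finally have "norm (arc_laplace r m 0) \<le> K / (r + 2) * P r" .
    moreover have "P r > 0" unfolding P_def by (rule integral_cos_powr_pos[OF r])
    moreover from this have "(of_real (P r) + arc_laplace r m 0) / of_real (P r) - 1 = arc_laplace r m 0 / of_real (P r)"
      by (simp add: add_divide_distrib)
    ultimately show ?thesis unfolding split arc_laplace_0_1 P_def[symmetric]
      by (simp only: norm_divide norm_of_real abs_of_pos pos_divide_le_eq)
  qed
  show ?thesis
  proof (rule Lim_null[THEN iffD2], rule Lim_null_comparison)
    show "\<forall>\<^sub>F n in sequentially. norm (arc_laplace (s + 2 * real n - 1) (\<lambda>z. cos (\<alpha> * z)) 0
        / arc_laplace (s + 2 * real n - 1) (\<lambda>z. 1) 0 - 1) \<le> K / (s + 2 * real n - 1 + 2)"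
      using s by (intro always_eventually allI bound) (simp add: add_pos_nonneg)
    show "(\<lambda>n. K / (s + 2 * real n - 1 + 2)) \<longlonglongrightarrow> 0" by real_asymp
  qed
qed

text \<open>The recurrence makes the ratio to the case \<open>\<alpha> = 0\<close> a product that telescopes to a quotient of Pochhammer symbols,
  that is, of Gamma functions. The case \<open>\<alpha> = 1/2\<close>, which is elementary, later eliminates the normalisation.\<close>

lemma arc_laplace_0_eq:
  fixes \<alpha> :: complex
  assumes s: "s > 0"
  defines "x \<equiv> of_real ((s + 1) / 2)"
  shows "arc_laplace (s - 1) (\<lambda>z. cos (\<alpha> * z)) 0 * rGamma x * rGamma x
    = arc_laplace (s - 1) (\<lambda>z. 1) 0 * rGamma (x - \<alpha> / 2) * rGamma (x + \<alpha> / 2)"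
proof -
  define J where "J n = arc_laplace (s + 2 * real n - 1) (\<lambda>z. cos (\<alpha> * z)) 0" for n
  define J0 where "J0 n = arc_laplace (s + 2 * real n - 1) (\<lambda>z. 1) 0" for n
  have J0_nz: "J0 n \<noteq> 0" for n
    unfolding J0_def arc_laplace_0_1 using integral_cos_powr_pos[of "s + 2 * real n - 1"] s by simp
  \<comment> \<open>In terms of y the recurrence factor (s + 2 n + 1)^2 - \<alpha>^2 is 4 (y -
    \<alpha>/2) (y + \<alpha>/2), the next factors of two Pochhammer symbols.\<close>
  define y where "y n = x + of_nat n" for n
  have y: "2 * y n = of_real (s + 2 * real n) + 1" for n
    by (simp add: y_def x_def)
  have sn: "s + 2 * real n > 0" for n using s by (simp add: add_pos_nonneg)
  have y_nz: "y n \<noteq> 0" for n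
  proof -
    have "y n = of_real ((s + 2 * real n + 1) / 2)" by (simp add: y_def x_def add_divide_distrib)
    then show ?thesis using sn[of n] by (simp only: of_real_eq_0_iff) auto
  qed
  have e: "s + 2 * real (Suc n) - 1 = s + 2 * real n + 1" for n by simp
  have rJ: "((2 * y n)\<^sup>2 - \<alpha>\<^sup>2) * J (Suc n) = of_real (s + 2 * real n) * (2 * y n) * J n" for n
    using arc_laplace_0_recurrence[OF sn[of n], of \<alpha>] unfolding J_def e y by simp
  have rJ0: "(2 * y n)\<^sup>2 * J0 (Suc n) = of_real (s + 2 * real n) * (2 * y n) * J0 n" for n
    using arc_laplace_0_recurrence[OF sn[of n], of 0] unfolding J0_def e y by simp
  \<comment> \<open>The recurrences for \<open>J\<close> and \<open>J0\<close> share their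
    right-hand factor, which cancels in the ratio. The other factors stay multiplied out because y -
    \<alpha>/2 or y + \<alpha>/2 may vanish.\<close>
  have step: "J n / J0 n * (y n)\<^sup>2 = (y n - \<alpha> / 2) * (y n + \<alpha> / 2) * (J (Suc n) / J0 (Suc n))" for n
  proof -
    have nz: "complex_of_real (s + 2 * real n) * (2 * y n) \<noteq> 0"
      using sn[of n] y_nz[of n] by (simp flip: of_real_add of_real_mult)
    have "of_real (s + 2 * real n) * (2 * y n) * (J n * (y n)\<^sup>2 * J0 (Suc n))
        = ((2 * y n)\<^sup>2 - \<alpha>\<^sup>2) * J (Suc n) * (y n)\<^sup>2 * J0 (Suc n)"
      unfolding rJ by (simp add: mult_ac)
    also have "\<dots> = (y n - \<alpha> / 2) * (y n + \<alpha> / 2) * J (Suc n) * ((2 * y n)\<^sup>2 * J0 (Suc n))"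
      by (simp add: field_simps power2_eq_square)
    also have "\<dots> = of_real (s + 2 * real n) * (2 * y n) * ((y n - \<alpha> / 2) * (y n + \<alpha> / 2) * J (Suc n) * J0 n)"
      unfolding rJ0 by (simp add: mult_ac)
    finally have "J n * (y n)\<^sup>2 * J0 (Suc n) = (y n - \<alpha> / 2) * (y n + \<alpha> / 2) * J (Suc n) * J0 n"
      using nz by (simp only: mult_cancel_left) auto
    then show ?thesis using J0_nz[of n] J0_nz[of "Suc n"] by (simp add: field_simps)
  qed
  have poch: "J 0 / J0 0 * (pochhammer x n)\<^sup>2
      = pochhammer (x - \<alpha> / 2) n * pochhammer (x + \<alpha> / 2) n * (J n / J0 n)" for n
  proof (induction n)
    case (Suc n)
    have "J 0 / J0 0 * (pochhammer x (Suc n))\<^sup>2 = (J 0 / J0 0 * (pochhammer x n)\<^sup>2) * (y n)\<^sup>2"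
      by (simp add: pochhammer_Suc y_def power_mult_distrib)
    also have "\<dots> = pochhammer (x - \<alpha> / 2) n * pochhammer (x + \<alpha> / 2) n * (J n / J0 n * (y n)\<^sup>2)"
      unfolding Suc by (simp add: mult_ac)
    also have "\<dots> = pochhammer (x - \<alpha> / 2) (Suc n) * pochhammer (x + \<alpha> / 2) (Suc n) * (J (Suc n) / J0 (Suc n))"
      unfolding step by (simp add: pochhammer_Suc y_def algebra_simps)
    finally show ?case .
  qed simp
  have series: "J 0 / J0 0 * (rGamma_series x n * rGamma_series x n)
      = rGamma_series (x - \<alpha> / 2) n * rGamma_series (x + \<alpha> / 2) n * (J (n + 1) / J0 (n + 1))" for n
  proof -
    define L where "L = complex_of_real (ln (real n))"
    \<comment> \<open>The arguments x - \<alpha>/2 and x + \<alpha>/2 sum to 2 x, so the powers of n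
      in the limit formula for 1/Gamma cancel. The index n + 1 below is the number of factors in
      \<open>rGamma_series\<close>.\<close>
    have ex: "exp ((x - \<alpha> / 2) * L) * exp ((x + \<alpha> / 2) * L) = exp (x * L) * exp (x * L)"
      unfolding exp_add[symmetric] by (simp add: algebra_simps)
    have "J 0 / J0 0 * (rGamma_series x n * rGamma_series x n)
        = (J 0 / J0 0 * (pochhammer x (n + 1))\<^sup>2) / (fact n * fact n * (exp (x * L) * exp (x * L)))"
      by (simp add: rGamma_series_def L_def power2_eq_square)
    also have "\<dots> = rGamma_series (x - \<alpha> / 2) n * rGamma_series (x + \<alpha> / 2) n * (J (n + 1) / J0 (n + 1))"
      unfolding poch ex[symmetric] by (simp add: rGamma_series_def L_def mult_ac)
    finally show ?thesis .
  qed
  have "(\<lambda>n. J 0 / J0 0 * (rGamma_series x n * rGamma_series x n)) \<longlonglongrightarrow> J 0 / J0 0 * (rGamma x * rGamma x)"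
    by (intro tendsto_intros)
  moreover have "(\<lambda>n. rGamma_series (x - \<alpha> / 2) n * rGamma_series (x + \<alpha> / 2) n * (J (n + 1) / J0 (n + 1)))
      \<longlonglongrightarrow> rGamma (x - \<alpha> / 2) * rGamma (x + \<alpha> / 2) * 1"
    using LIMSEQ_ignore_initial_segment[OF arc_laplace_0_ratio[OF s, of \<alpha>], of 1]
    unfolding J_def J0_def by (intro tendsto_mult rGamma_series_LIMSEQ) auto
  ultimately have "J 0 / J0 0 * (rGamma x * rGamma x) = rGamma (x - \<alpha> / 2) * rGamma (x + \<alpha> / 2)"
    unfolding series using LIMSEQ_unique by fastforce
  then have "J 0 * rGamma x * rGamma x = J0 0 * rGamma (x - \<alpha> / 2) * rGamma (x + \<alpha> / 2)"
    using J0_nz[of 0] by (simp add: field_simps)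
  then show ?thesis by (simp add: J_def J0_def)
qed

lemma arc_laplace_0_FTC:
  fixes F f :: "real \<Rightarrow> real"
  assumes r: "r > -1"
    and F: "\<And>x. x \<in> {0<..<pi/2} \<Longrightarrow> (F has_real_derivative cos x powr r * f x) (at x)"
    and cF: "continuous_on {0..pi/2} F" and fg: "\<And>x. g (complex_of_real x) = of_real (f x)"
    and g: "continuous_on UNIV g"
  shows "arc_laplace r g 0 = of_real (F (pi/2) - F 0)"
proof -
  have "arc_laplace r g 0 = complex_of_real (F (pi/2)) - of_real (F 0)"
    unfolding arc_laplace_def
  proof (rule integral_quarter_FTC)
    show "((\<lambda>x. complex_of_real (F x)) has_vector_derivative
        exp (- 0 / of_real (cos x)) * of_real (cos x powr r) * g (of_real x)) (at x)" if "x \<in> {0<..<pi/2}" for x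
      using has_vector_derivative_of_real[OF F[OF that]] fg
      by (simp add: has_real_derivative_iff_has_vector_derivative)
    show "((\<lambda>x. complex_of_real (F x)) \<longlongrightarrow> of_real (F 0)) (at_right 0)"
      using cF by (intro tendsto_of_real continuous_on_Icc_at_rightD) auto
    show "((\<lambda>x. complex_of_real (F x)) \<longlongrightarrow> of_real (F (pi/2))) (at_left (pi/2))"
      using cF by (intro tendsto_of_real continuous_on_Icc_at_leftD) auto
    show "continuous_on {0<..<pi/2} (\<lambda>x. exp (- 0 / of_real (cos x)) * of_real (cos x powr r) * g (of_real x))"
      by (rule continuous_arc_integrand[OF g])
    show "integrable quarter (\<lambda>x. exp (- 0 / of_real (cos x)) * of_real (cos x powr r) * g (of_real x))"
      using r by (intro integrable_arc_laplace g) auto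
  qed
  then show ?thesis by simp
qed

lemma cos_eq_half_angle: "cos x = 1 - 2 * (sin (x / 2))\<^sup>2" for x :: real
  using cos_double_sin[of "x / 2"] by simp

text \<open>At \<alpha> = 1/2 the substitution u = sqrt 2 sin(x/2) works: cos x = 1 - u^2 and
  cos(x/2) dx = sqrt 2 du. This leaves sqrt 2 times the integrals over (0,1) of (1 - u^2)^(-1/2) and
  (1 - u^2)^(1/2), that is pi/2 and the area pi/4 of a quarter disc.\<close>

lemma arc_laplace_base_values:
  shows "arc_laplace (- 1 / 2) (\<lambda>z. cos (1 / 2 * z)) 0 = of_real (sqrt 2 * pi / 2)"
    and "arc_laplace (1 / 2) (\<lambda>z. cos (1 / 2 * z)) 0 = of_real (sqrt 2 * pi / 4)"
proof -
  define u where "u x = sqrt 2 * sin (x / 2)" for x :: real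
  have u2: "1 - (u x)\<^sup>2 = cos x" for x
    by (simp add: u_def power_mult_distrib cos_eq_half_angle[of x])
  have u_bd: "\<bar>u x\<bar> \<le> 1" if "x \<in> {0..pi/2}" for x
    using u2[of x] cos_ge_zero[of x] that by (simp add: abs_square_le_1[symmetric])
  have u_lt: "\<bar>u x\<bar> < 1" if "x \<in> {0<..<pi/2}" for x
    using u2[of x] cos_gt_zero[of x] that by (simp add: abs_square_less_1[symmetric])
  have du: "(u has_real_derivative sqrt 2 / 2 * cos (x / 2)) (at x)" for x
    unfolding u_def[abs_def] by (auto intro!: derivative_eq_intros)
  have ends: "u 0 = 0" "u (pi/2) = 1"
    by (simp_all add: u_def sin_45)
  have das: "((\<lambda>x. arcsin (u x)) has_real_derivative sqrt 2 / 2 * cos (x / 2) / sqrt (cos x)) (at x)"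
    if "x \<in> {0<..<pi/2}" for x
  proof -
    have "(arcsin has_real_derivative inverse (sqrt (1 - (u x)\<^sup>2))) (at (u x))"
      using u_lt[OF that] by (intro DERIV_arcsin) linarith+
    from DERIV_chain2[OF this du] show ?thesis
      unfolding u2 by (simp only: divide_inverse mult.commute)
  qed
  have cu: "continuous_on {0..pi/2} u" unfolding u_def by (intro continuous_intros) auto
  have cas: "continuous_on {0..pi/2} (\<lambda>x. arcsin (u x))"
    using u_bd by (intro continuous_on_arcsin cu) (auto simp: abs_le_iff)
  have g: "continuous_on UNIV (\<lambda>z::complex. cos (1 / 2 * z))" by (intro continuous_intros)
  have fg: "cos (1 / 2 * complex_of_real x) = of_real (cos (x / 2))" for x
    using cos_of_real[of "x / 2", where ?'a = complex] by simp
  have "arc_laplace (- 1 / 2) (\<lambda>z. cos (1 / 2 * z)) 0 = of_real (sqrt 2 * arcsin (u (pi/2)) - sqrt 2 * arcsin (u 0))"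
  proof (rule arc_laplace_0_FTC[OF _ _ _ fg g])
    show "((\<lambda>x. sqrt 2 * arcsin (u x)) has_real_derivative cos x powr (- 1 / 2) * cos (x / 2)) (at x)"
      if x: "x \<in> {0<..<pi/2}" for x
    proof -
      have c: "cos x > 0" using x by (simp add: cos_gt_zero)
      have "((\<lambda>x. sqrt 2 * arcsin (u x)) has_real_derivative sqrt 2 * (sqrt 2 / 2 * cos (x / 2) / sqrt (cos x))) (at x)"
        by (intro DERIV_cmult das x)
      also have "sqrt 2 * (sqrt 2 / 2 * cos (x / 2) / sqrt (cos x)) = cos x powr (- 1 / 2) * cos (x / 2)"
        using c by (simp add: powr_minus_divide powr_half_sqrt mult.assoc[symmetric])
      finally show ?thesis .
    qed
    show "continuous_on {0..pi/2} (\<lambda>x. sqrt 2 * arcsin (u x))" by (intro continuous_intros cas)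
  qed simp
  then show "arc_laplace (- 1 / 2) (\<lambda>z. cos (1 / 2 * z)) 0 = of_real (sqrt 2 * pi / 2)"
    by (simp add: ends)
  \<comment> \<open>This is sqrt 2 times the usual primitive (arcsin u + u sqrt(1 - u^2)) /
    2.\<close>
  define F where "F x = sqrt 2 / 2 * (arcsin (u x) + u x * sqrt (cos x))" for x
  have "arc_laplace (1 / 2) (\<lambda>z. cos (1 / 2 * z)) 0 = of_real (F (pi/2) - F 0)"
  proof (rule arc_laplace_0_FTC[OF _ _ _ fg g])
    show "(F has_real_derivative cos x powr (1 / 2) * cos (x / 2)) (at x)"
      if x: "x \<in> {0<..<pi/2}" for x
    proof -
      have c: "cos x > 0" using x by (simp add: cos_gt_zero)
      define k where "k = sqrt (cos x)"
      have k: "k > 0" "cos x = k\<^sup>2" using c by (simp_all add: k_def)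
      have "((\<lambda>x. sqrt (cos x)) has_real_derivative inverse k / 2 * - sin x) (at x)"
        unfolding k_def by (rule DERIV_chain2[OF DERIV_real_sqrt[OF c] DERIV_cos])
      then have "(F has_real_derivative sqrt 2 / 2 * (sqrt 2 / 2 * cos (x / 2) / k
          + (sqrt 2 / 2 * cos (x / 2) * k + inverse k / 2 * - sin x * u x))) (at x)"
        unfolding F_def[abs_def] k_def by (intro DERIV_cmult DERIV_add DERIV_mult das x du)
      also have "sqrt 2 / 2 * (sqrt 2 / 2 * cos (x / 2) / k
          + (sqrt 2 / 2 * cos (x / 2) * k + inverse k / 2 * - sin x * u x)) = k * cos (x / 2)"
      proof -
        have s: "sin x = 2 * sin (x / 2) * cos (x / 2)" using sin_double[of "x / 2"] by simp
        have h: "k\<^sup>2 = 1 - 2 * (sin (x / 2))\<^sup>2" using cos_eq_half_angle[of x] k by simp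
        have "A / 2 * (A / 2 * cos (x / 2) / k + (A / 2 * cos (x / 2) * k + inverse k / 2 * - sin x * (A * sin (x / 2))))
          = A\<^sup>2 / 2 * ((cos (x / 2) * (1 + k\<^sup>2 - 2 * (sin (x / 2))\<^sup>2)) / (2 * k))" for A
          using k(1) unfolding s by (simp add: field_simps power2_eq_square)
        from this[of "sqrt 2"] have "sqrt 2 / 2 * (sqrt 2 / 2 * cos (x / 2) / k
            + (sqrt 2 / 2 * cos (x / 2) * k + inverse k / 2 * - sin x * u x))
          = (cos (x / 2) * (1 + k\<^sup>2 - 2 * (sin (x / 2))\<^sup>2)) / (2 * k)"
          by (simp add: u_def)
        also have "1 + k\<^sup>2 - 2 * (sin (x / 2))\<^sup>2 = 2 * k\<^sup>2" using h by simp
        finally show ?thesis using k(1) by (simp add: power2_eq_square)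
      qed
      also have "k = cos x powr (1 / 2)" using c by (simp add: k_def powr_half_sqrt)
      finally show ?thesis .
    qed
    show "continuous_on {0..pi/2} F" unfolding F_def by (intro continuous_intros cas cu)
  qed simp
  then show "arc_laplace (1 / 2) (\<lambda>z. cos (1 / 2 * z)) 0 = of_real (sqrt 2 * pi / 4)"
    by (simp add: F_def ends)
qed

text \<open>The exponents -1/2 and 1/2 belong to s = 1/2 and s = 3/2, hence to the centres (s + 1)/2
  = 3/4 and 5/4. At \<alpha> = 1/2 the Gamma arguments become 1/2, 1 and 1, 3/2, so the elementary
  values express the integral with \<alpha> = 0 as a multiple of rGamma(3/4)^2 or rGamma(5/4)^2,
  which then cancels.\<close>

lemma arc_laplace_cos_values:
  fixes \<alpha> :: complex
  shows "arc_laplace (- 1 / 2) (\<lambda>z. cos (\<alpha> * z)) 0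
      = of_real (sqrt 2 * pi / 2) * of_real (sqrt pi) * rGamma (3 / 4 - \<alpha> / 2) * rGamma (3 / 4 + \<alpha> / 2)"
    and "arc_laplace (1 / 2) (\<lambda>z. cos (\<alpha> * z)) 0
      = of_real (sqrt 2 * pi / 4) * (of_real (sqrt pi) / 2) * rGamma (5 / 4 - \<alpha> / 2) * rGamma (5 / 4 + \<alpha> / 2)"
proof -
  have h: "(1/2::complex) \<notin> \<int>\<^sub>\<le>\<^sub>0" "(3/4::complex) \<notin> \<int>\<^sub>\<le>\<^sub>0" "(5/4::complex) \<notin> \<int>\<^sub>\<le>\<^sub>0"
    by (auto elim!: nonpos_Ints_cases simp: complex_eq_iff)
  have nz: "rGamma (3/4::complex) \<noteq> 0" "rGamma (5/4::complex) \<noteq> 0"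
    using h by (auto simp: rGamma_eq_zero_iff)
  have r1: "rGamma (1/2::complex) = 1 / of_real (sqrt pi)"
    by (simp only: rGamma_inverse_Gamma Gamma_one_half_complex inverse_eq_divide)
  have r3: "rGamma (3/2::complex) = 2 / of_real (sqrt pi)"
    using rGamma_plus1[of "1/2::complex"] r1 by simp
  define J where "J = arc_laplace (- 1 / 2) (\<lambda>z. 1) 0"
  have e: "arc_laplace (- 1 / 2) (\<lambda>z. cos (\<beta> * z)) 0 * rGamma (3/4) * rGamma (3/4)
      = J * rGamma (3/4 - \<beta> / 2) * rGamma (3/4 + \<beta> / 2)" for \<beta> :: complex
    using arc_laplace_0_eq[of "1/2" \<beta>] by (simp add: J_def)
  have J: "J = of_real (sqrt 2 * pi / 2) * of_real (sqrt pi) * rGamma (3/4) * rGamma (3/4)"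
    using e[of "1/2"] unfolding arc_laplace_base_values by (simp add: r1 field_simps)
  show "arc_laplace (- 1 / 2) (\<lambda>z. cos (\<alpha> * z)) 0
      = of_real (sqrt 2 * pi / 2) * of_real (sqrt pi) * rGamma (3 / 4 - \<alpha> / 2) * rGamma (3 / 4 + \<alpha> / 2)"
    using e[of \<alpha>] nz unfolding J by (simp add: mult_ac)
  define L where "L = arc_laplace (1 / 2) (\<lambda>z. 1) 0"
  have e': "arc_laplace (1 / 2) (\<lambda>z. cos (\<beta> * z)) 0 * rGamma (5/4) * rGamma (5/4)
      = L * rGamma (5/4 - \<beta> / 2) * rGamma (5/4 + \<beta> / 2)" for \<beta> :: complex
    using arc_laplace_0_eq[of "3/2" \<beta>] by (simp add: L_def)
  have L: "L = of_real (sqrt 2 * pi / 4) * (of_real (sqrt pi) / 2) * rGamma (5/4) * rGamma (5/4)"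
    using e'[of "1/2"] unfolding arc_laplace_base_values by (simp add: r3 field_simps)
  show "arc_laplace (1 / 2) (\<lambda>z. cos (\<alpha> * z)) 0
      = of_real (sqrt 2 * pi / 4) * (of_real (sqrt pi) / 2) * rGamma (5 / 4 - \<alpha> / 2) * rGamma (5 / 4 + \<alpha> / 2)"
    using e'[of \<alpha>] nz unfolding L by (simp add: mult_ac)
qed

section \<open>Parabolic cylinder functions\<close>

text \<open>If \<open>u'' = (z\<^sup>2/4 + \<alpha>) u\<close> and \<open>v'' = (z\<^sup>2/4 - \<alpha>) v\<close>, then \<open>(f, h, g, w) = (u v, (u v)', u' v', u v' - u' v)\<close>
  solves this system.\<close>

lemma product_system_unique:
  fixes f h g w :: "real \<Rightarrow> complex" and \<alpha> :: complex
  assumes f: "\<And>z. z > 0 \<Longrightarrow> (f has_vector_derivative h z) (at z)"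
    and h: "\<And>z. z > 0 \<Longrightarrow> (h has_vector_derivative z\<^sup>2 / 2 * f z + 2 * g z) (at z)"
    and g: "\<And>z. z > 0 \<Longrightarrow> (g has_vector_derivative z\<^sup>2 / 4 * h z + \<alpha> * w z) (at z)"
    and w: "\<And>z. z > 0 \<Longrightarrow> (w has_vector_derivative - 2 * \<alpha> * f z) (at z)"
    and lim: "(f \<longlongrightarrow> 0) (at_right 0)" "(h \<longlongrightarrow> 0) (at_right 0)"
      "(g \<longlongrightarrow> 0) (at_right 0)" "(w \<longlongrightarrow> 0) (at_right 0)"
    and x: "x > 0"
  shows "f x = 0"
proof -
  \<comment> \<open>Squared Euclidean norm of the solution vector. Only limits at 0 are known, so
    values at y and x are compared and y tends to 0 afterwards.\<close>
  define N where "N z = f z \<bullet> f z + h z \<bullet> h z + g z \<bullet> g z + w z \<bullet> w z" for z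
  define N' where "N' z = 2 * (f z \<bullet> h z + h z \<bullet> (z\<^sup>2 / 2 * f z + 2 * g z)
      + g z \<bullet> (z\<^sup>2 / 4 * h z + \<alpha> * w z) + w z \<bullet> (- 2 * \<alpha> * f z))" for z :: real
  \<comment> \<open>One summand for each of the six cross terms of \<open>N'\<close>, with z \<le> x
    bounding the polynomial coefficients uniformly.\<close>
  define K where "K = 1 + x\<^sup>2 + 2 + x\<^sup>2 + norm \<alpha> + 2 * norm \<alpha>"
  have dN: "(N has_real_derivative N' z) (at z)" if "z > 0" for z
  proof -
    have "((\<lambda>z. f z \<bullet> f z + h z \<bullet> h z + g z \<bullet> g z + w z \<bullet> w z) has_derivative (\<lambda>t. t * N' z)) (at z)"
      using f[OF that] h[OF that] g[OF that] w[OF that] unfolding has_vector_derivative_def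
      by (auto intro!: derivative_eq_intros simp: N'_def algebra_simps inner_commute inner_add_left
          inner_add_right fun_eq_iff)
    then show ?thesis
      by (simp add: N_def[abs_def] has_field_derivative_def mult_commute_abs)
  qed
  have young: "2 * (u \<bullet> (k * v)) \<le> norm k * (u \<bullet> u + v \<bullet> v)" for u v k :: complex
  proof -
    have "2 * (u \<bullet> (k * v)) \<le> 2 * (norm u * (norm k * norm v))"
      using norm_cauchy_schwarz[of u "k * v"] by (simp add: norm_mult)
    also have "\<dots> \<le> norm k * ((norm u)\<^sup>2 + (norm v)\<^sup>2)"
      using mult_left_mono[OF sum_squares_bound[of "norm u" "norm v"], of "norm k"]
      by (simp add: algebra_simps)
    finally show ?thesis by (simp add: power2_norm_eq_inner)
  qed
  have N'_le: "N' z \<le> K * N z" if "0 < z" "z \<le> x" for z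
  proof -
    have z2: "z\<^sup>2 \<le> x\<^sup>2" using that by (simp add: power_mono)
    have nn: "f z \<bullet> f z \<ge> 0" "h z \<bullet> h z \<ge> 0" "g z \<bullet> g z \<ge> 0" "w z \<bullet> w z \<ge> 0" by auto
    have n1: "norm (complex_of_real z ^ 2 / 2) = z\<^sup>2 / 2" "norm (complex_of_real z ^ 2 / 4) = z\<^sup>2 / 4"
      by (simp_all add: norm_divide norm_power)
    have a: "2 * (f z \<bullet> h z) \<le> f z \<bullet> f z + h z \<bullet> h z" using young[of "f z" 1 "h z"] by simp
    have b: "2 * (h z \<bullet> (z\<^sup>2 / 2 * f z)) \<le> z\<^sup>2 / 2 * (h z \<bullet> h z + f z \<bullet> f z)"
      using young[of "h z" "z\<^sup>2/2" "f z"] n1 by simp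
    have c: "2 * (h z \<bullet> (2 * g z)) \<le> 2 * (h z \<bullet> h z + g z \<bullet> g z)"
      using young[of "h z" 2 "g z"] by simp
    have d: "2 * (g z \<bullet> (z\<^sup>2 / 4 * h z)) \<le> z\<^sup>2 / 4 * (g z \<bullet> g z + h z \<bullet> h z)"
      using young[of "g z" "z\<^sup>2/4" "h z"] n1 by simp
    have e: "2 * (g z \<bullet> (\<alpha> * w z)) \<le> norm \<alpha> * (g z \<bullet> g z + w z \<bullet> w z)"
      using young[of "g z" \<alpha> "w z"] by simp
    have k: "2 * (w z \<bullet> (- 2 * \<alpha> * f z)) \<le> 2 * norm \<alpha> * (w z \<bullet> w z + f z \<bullet> f z)"
      using young[of "w z" "- 2 * \<alpha>" "f z"] by (simp add: norm_mult)
    have *: "r * (u + v) \<le> r' * N z"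
      if "r \<le> r'" "0 \<le> r" "u + v \<le> N z" "0 \<le> u" "0 \<le> v" for r r' u v
      using that by (intro mult_mono) auto
    have "N' z \<le> 1 * (f z \<bullet> f z + h z \<bullet> h z) + z\<^sup>2 / 2 * (h z \<bullet> h z + f z \<bullet> f z)
        + 2 * (h z \<bullet> h z + g z \<bullet> g z) + z\<^sup>2 / 4 * (g z \<bullet> g z + h z \<bullet> h z)
        + norm \<alpha> * (g z \<bullet> g z + w z \<bullet> w z) + 2 * norm \<alpha> * (w z \<bullet> w z + f z \<bullet> f z)"
      using a b c d e k unfolding N'_def by (simp add: inner_add_right algebra_simps)
    also have "\<dots> \<le> 1 * N z + x\<^sup>2 * N z + 2 * N z + x\<^sup>2 * N z + norm \<alpha> * N z + 2 * norm \<alpha> * N z"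
      using z2 nn by (intro add_mono *) (auto simp: N_def intro: order_trans[OF z2])
    finally show ?thesis by (simp add: K_def algebra_simps)
  qed
  have mono: "N x * exp (- K * x) \<le> N y * exp (- K * y)" if "0 < y" "y \<le> x" for y
  proof (rule DERIV_nonpos_imp_nonincreasing[OF that(2)])
    fix z assume z: "y \<le> z" "z \<le> x"
    then have "z > 0" using that by simp
    have "((\<lambda>z. N z * exp (- K * z)) has_real_derivative (N' z - K * N z) * exp (- K * z)) (at z)"
      using \<open>z > 0\<close> by (auto intro!: derivative_eq_intros dN simp: algebra_simps)
    moreover have "(N' z - K * N z) * exp (- K * z) \<le> 0"
      using N'_le[OF \<open>z > 0\<close> z(2)] by (simp add: mult_le_0_iff)
    ultimately show "\<exists>d. ((\<lambda>z. N z * exp (- K * z)) has_real_derivative d) (at z) \<and> d \<le> 0"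
      by blast
  qed
  have "((\<lambda>y. N y * exp (- K * y)) \<longlongrightarrow> (0 \<bullet> (0::complex) + 0 \<bullet> (0::complex) + 0 \<bullet> (0::complex) + 0 \<bullet> (0::complex)) * exp (- K * 0)) (at_right 0)"
    unfolding N_def by (intro tendsto_intros lim)
  then have "((\<lambda>y. N y * exp (- K * y)) \<longlongrightarrow> 0) (at_right 0)" by simp
  moreover have "\<forall>\<^sub>F y in at_right 0. N x * exp (- K * x) \<le> N y * exp (- K * y)"
    using mono x by (intro eventually_at_rightI[of 0 x]) auto
  ultimately have "N x * exp (- K * x) \<le> 0"
    by (intro tendsto_lowerbound) auto
  then have "N x \<le> 0" by (simp add: mult_le_0_iff)
  moreover have "f x \<bullet> f x \<ge> 0" "h x \<bullet> h x \<ge> 0" "g x \<bullet> g x \<ge> 0" "w x \<bullet> w x \<ge> 0" by auto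
  ultimately have "f x \<bullet> f x = 0" unfolding N_def by linarith
  then show ?thesis by simp
qed

text \<open>Kummer's equation amounts to the coefficient recurrence (n + 1)(b + n) m(n+1) = (a + n)
  m(n). The hypothesis on \<open>b\<close> keeps all denominators nonzero. The ratio of successive
  terms tends to 0, so the series and its termwise derivatives converge everywhere.\<close>

lemma kummer_Phi_ODE:
  fixes a b :: complex
  assumes b: "b \<notin> \<int>\<^sub>\<le>\<^sub>0"
  obtains M' M'' where
    "\<And>x. (kummer_Phi a b has_field_derivative M' x) (at x)"
    "\<And>x. (M' has_field_derivative M'' x) (at x)"
    "\<And>x. x * M'' x + (b - x) * M' x - a * kummer_Phi a b x = 0"
proof -
  define m where "m n = pochhammer a n / pochhammer b n / fact n" for n
  have bn: "b + of_nat n \<noteq> 0" for n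
  proof
    assume "b + of_nat n = 0"
    then have "b = - of_nat n" by (simp add: eq_neg_iff_add_eq_0)
    with b show False by simp
  qed
  have rec: "of_nat (Suc n) * (b + of_nat n) * m (Suc n) = (a + of_nat n) * m n" for n
    using bn[of n] by (simp add: m_def pochhammer_Suc divide_simps del: of_nat_Suc)
  have summ: "summable (\<lambda>n. m n * x ^ n)" for x
  proof -
    have "((\<lambda>n. (norm a + real n) / ((real n - norm b) * (real n + 1)) * norm x) \<longlongrightarrow> 0) sequentially"
      by real_asymp
    then have "\<forall>\<^sub>F n in sequentially. (norm a + real n) / ((real n - norm b) * (real n + 1)) * norm x < 1/2"
      by (rule order_tendstoD) simp
    moreover have "\<forall>\<^sub>F n in sequentially. real n > norm b" by real_asymp
    ultimately have "\<forall>\<^sub>F n in sequentially. norm (m (Suc n) * x ^ Suc n) \<le> 1/2 * norm (m n * x ^ n)"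
    proof eventually_elim
      case (elim n)
      have "m (Suc n) * x ^ Suc n = (a + of_nat n) / ((b + of_nat n) * of_nat (Suc n)) * x * (m n * x ^ n)"
        using rec[of n] bn[of n] by (simp add: divide_simps mult_ac del: of_nat_Suc)
      also have "norm \<dots> = norm (a + of_nat n) / (norm (b + of_nat n) * real (Suc n)) * norm x * norm (m n * x ^ n)"
        by (simp add: norm_mult norm_divide del: of_nat_Suc)
      also have "\<dots> \<le> (norm a + real n) / ((real n - norm b) * (real n + 1)) * norm x * norm (m n * x ^ n)"
        using elim norm_triangle_ineq[of a "of_nat n"] norm_diff_ineq[of "of_nat n" b]
        by (intro mult_right_mono frac_le mult_mono) (auto simp: add.commute)
      also have "\<dots> \<le> 1/2 * norm (m n * x ^ n)"
        using elim by (intro mult_right_mono) auto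
      finally show ?case .
    qed
    then obtain N where "\<And>n. n \<ge> N \<Longrightarrow> norm (m (Suc n) * x ^ Suc n) \<le> 1/2 * norm (m n * x ^ n)"
      by (auto simp: eventually_sequentially)
    then show ?thesis by (intro summable_ratio_test[of "1/2" N]) auto
  qed
  define M' where "M' x = (\<Sum>n. diffs m n * x ^ n)" for x
  define M'' where "M'' x = (\<Sum>n. diffs (diffs m) n * x ^ n)" for x
  have K: "kummer_Phi a b = (\<lambda>x. \<Sum>n. m n * x ^ n)"
    by (simp add: kummer_Phi_def m_def fun_eq_iff)
  have summ': "summable (\<lambda>n. diffs m n * x ^ n)" for x
    by (rule termdiff_converges_all) (rule summ)
  have summ'': "summable (\<lambda>n. diffs (diffs m) n * x ^ n)" for x
    by (rule termdiff_converges_all) (rule summ')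
  have ode: "x * M'' x + (b - x) * M' x - a * kummer_Phi a b x = 0" for x
  proof -
    \<comment> \<open>Multiplying the derived series by x acts on coefficients as multiplication by
      n; this aligns all series at the same power of x.\<close>
    have xd: "(\<lambda>n. of_nat n * d n * x ^ n) sums (x * (\<Sum>n. diffs d n * x ^ n))"
      if "summable (\<lambda>n. diffs d n * x ^ n)" for d :: "nat \<Rightarrow> complex"
    proof -
      have "(\<lambda>n. x * (diffs d n * x ^ n)) sums (x * (\<Sum>n. diffs d n * x ^ n))"
        by (intro sums_mult summable_sums that)
      then have "(\<lambda>n. of_nat (Suc n) * d (Suc n) * x ^ Suc n) sums (x * (\<Sum>n. diffs d n * x ^ n))"
        by (simp add: diffs_def mult_ac)
      then show ?thesis using sums_Suc[of "\<lambda>n. of_nat n * d n * x ^ n"] by simp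
    qed
    have "(\<lambda>n. of_nat n * diffs m n * x ^ n + b * (diffs m n * x ^ n) - of_nat n * m n * x ^ n - a * (m n * x ^ n))
        sums (x * M'' x + b * M' x - x * M' x - a * (\<Sum>n. m n * x ^ n))"
      unfolding M''_def M'_def
      by (intro sums_add sums_diff sums_mult summable_sums xd summ summ' summ'')
    moreover have "of_nat n * diffs m n * x ^ n + b * (diffs m n * x ^ n) - of_nat n * m n * x ^ n - a * (m n * x ^ n) = 0" for n
    proof -
      have "of_nat n * diffs m n * x ^ n + b * (diffs m n * x ^ n) - of_nat n * m n * x ^ n - a * (m n * x ^ n)
        = (of_nat (Suc n) * (b + of_nat n) * m (Suc n) - (a + of_nat n) * m n) * x ^ n"
        by (simp add: diffs_def algebra_simps)
      then show ?thesis using rec[of n] by simp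
    qed
    ultimately have "(\<lambda>n. 0) sums (x * M'' x + b * M' x - x * M' x - a * (\<Sum>n. m n * x ^ n))" by simp
    then have "x * M'' x + b * M' x - x * M' x - a * (\<Sum>n. m n * x ^ n) = 0"
      by (rule sums_unique2[OF _ sums_zero])
    then show ?thesis unfolding K by (simp add: algebra_simps)
  qed
  show ?thesis
  proof (rule that[OF _ _ ode])
    show "(kummer_Phi a b has_field_derivative M' x) (at x)" for x
      unfolding K M'_def by (rule termdiffs_strong_converges_everywhere) (rule summ)
    show "(M' has_field_derivative M'' x) (at x)" for x
      unfolding M''_def M'_def[abs_def] by (rule termdiffs_strong_converges_everywhere) (rule summ')
  qed
qed

lemma kummer_Phi_0: "kummer_Phi a b 0 = 1"
  unfolding kummer_Phi_def using powser_zero[of "\<lambda>n. pochhammer a n / pochhammer b n / fact n"] by simp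

text \<open>Without its Gaussian factor the function is, up to a constant, a combination of the even
  and the odd solution of y'' = z y' - \<nu> y, each governed by Kummer's equation in z^2/2. As
  Kummer's function is 1 at 0, the even one alone gives the value at 0 and the odd one alone the
  derivative.\<close>

lemma parabolic_cylinder_D_ODE:
  obtains D' where
    "\<And>z. (parabolic_cylinder_D \<nu> has_field_derivative D' z) (at z)"
    "\<And>z. (D' has_field_derivative (z\<^sup>2 / 4 - \<nu> - 1 / 2) * parabolic_cylinder_D \<nu> z) (at z)"
    "parabolic_cylinder_D \<nu> 0 = 2 powr (\<nu> / 2) * of_real (sqrt pi) * rGamma ((1 - \<nu>) / 2)"
    "D' 0 = - (2 powr (\<nu> / 2) * of_real (sqrt 2) * of_real (sqrt pi) * rGamma (- \<nu> / 2))"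
proof -
  have b: "(1/2::complex) \<notin> \<int>\<^sub>\<le>\<^sub>0" "(3/2::complex) \<notin> \<int>\<^sub>\<le>\<^sub>0"
    by (auto elim!: nonpos_Ints_cases simp: complex_eq_iff)
  obtain M' M'' where M:
    "\<And>x. (kummer_Phi (- \<nu> / 2) (1/2) has_field_derivative M' x) (at x)"
    "\<And>x. (M' has_field_derivative M'' x) (at x)"
    "\<And>x. x * M'' x + (1/2 - x) * M' x - (- \<nu> / 2) * kummer_Phi (- \<nu> / 2) (1/2) x = 0"
    using kummer_Phi_ODE[OF b(1)] by metis
  obtain O' O'' where O:
    "\<And>x. (kummer_Phi ((1 - \<nu>) / 2) (3/2) has_field_derivative O' x) (at x)"
    "\<And>x. (O' has_field_derivative O'' x) (at x)"
    "\<And>x. x * O'' x + (3/2 - x) * O' x - ((1 - \<nu>) / 2) * kummer_Phi ((1 - \<nu>) / 2) (3/2) x = 0"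
    using kummer_Phi_ODE[OF b(2)] by metis
  define M0 where "M0 = kummer_Phi (- \<nu> / 2) (1/2)"
  define O0 where "O0 = kummer_Phi ((1 - \<nu>) / 2) (3/2)"
  define A where "A = Gamma (1 / 2) * rGamma ((1 - \<nu>) / 2)"
  define B where "B = Gamma (- 1 / 2) * rGamma (- \<nu> / 2) / csqrt 2"
  define y where "y z = A * M0 (z\<^sup>2 / 2) + B * (z * O0 (z\<^sup>2 / 2))" for z
  define y' where "y' z = A * (z * M' (z\<^sup>2 / 2)) + B * (O0 (z\<^sup>2 / 2) + z\<^sup>2 * O' (z\<^sup>2 / 2))" for z
  define k where "k = (2::complex) powr (\<nu> / 2)"
  note [derivative_intros] = M(1,2)[folded M0_def, THEN DERIV_chain2] O(1,2)[folded O0_def, THEN DERIV_chain2]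
  have D: "parabolic_cylinder_D \<nu> z = k * exp (- z\<^sup>2 / 4) * y z" for z
    by (simp add: parabolic_cylinder_D_def y_def k_def A_def B_def M0_def O0_def)
  have dy: "(y has_field_derivative y' z) (at z)" for z
    unfolding y_def[abs_def] y'_def by (auto intro!: derivative_eq_intros simp: power2_eq_square algebra_simps)
  have dy': "(y' has_field_derivative z * y' z - \<nu> * y z) (at z)" for z
  proof -
    \<comment> \<open>Twice Kummer's equation at z^2/2; \<open>o\<close> is the same for the odd
      solution.\<close>
    have m: "z\<^sup>2 * M'' (z\<^sup>2/2) = (z\<^sup>2 - 1) * M' (z\<^sup>2/2) - \<nu> * M0 (z\<^sup>2/2)"
      using M(3)[of "z\<^sup>2/2"] by (simp add: M0_def field_simps)
    have o: "z\<^sup>2 * O'' (z\<^sup>2/2) = (z\<^sup>2 - 3) * O' (z\<^sup>2/2) + (1 - \<nu>) * O0 (z\<^sup>2/2)"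
      using O(3)[of "z\<^sup>2/2"] unfolding O0_def by algebra
    have "(y' has_field_derivative A * (M' (z\<^sup>2/2) + z\<^sup>2 * M'' (z\<^sup>2/2)) + B * (z * O' (z\<^sup>2/2) + 2 * z * O' (z\<^sup>2/2)
       + z * (z\<^sup>2 * O'' (z\<^sup>2/2)))) (at z)"
      unfolding y'_def[abs_def] by (auto intro!: derivative_eq_intros simp: power2_eq_square algebra_simps)
    also have "A * (M' (z\<^sup>2/2) + z\<^sup>2 * M'' (z\<^sup>2/2)) + B * (z * O' (z\<^sup>2/2) + 2 * z * O' (z\<^sup>2/2)
       + z * (z\<^sup>2 * O'' (z\<^sup>2/2))) = z * y' z - \<nu> * y z"
      unfolding m o y'_def y_def by (simp add: algebra_simps power2_eq_square)
    finally show ?thesis .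
  qed
  define D' where "D' z = k * exp (- z\<^sup>2 / 4) * (y' z - z / 2 * y z)" for z
  note [derivative_intros] = dy[THEN DERIV_chain2] dy'[THEN DERIV_chain2]
  show ?thesis
  proof (rule that)
    show "(parabolic_cylinder_D \<nu> has_field_derivative D' z) (at z)" for z
      unfolding D[abs_def] D'_def by (auto intro!: derivative_eq_intros simp: algebra_simps)
    show "(D' has_field_derivative (z\<^sup>2 / 4 - \<nu> - 1 / 2) * parabolic_cylinder_D \<nu> z) (at z)" for z
      unfolding D D'_def[abs_def]
      by (auto intro!: derivative_eq_intros simp: field_simps power2_eq_square)
    have G: "Gamma (1/2::complex) = of_real (sqrt pi)"
      using Gamma_one_half_complex by simp
    \<comment> \<open>This value accounts for the minus sign and, through 2 / sqrt 2 = sqrt 2, for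
      the factor in \<open>D' 0\<close>.\<close>
    have G': "Gamma (-1/2::complex) = - 2 * of_real (sqrt pi)"
    proof -
      have "(-1/2::complex) \<notin> \<int>\<^sub>\<le>\<^sub>0"
        using fraction_not_in_Ints[of 2 "-1", where ?'a = complex] nonpos_Ints_subset_Ints by auto
      then show ?thesis using Gamma_plus1[of "-1/2::complex"] G by (simp add: field_simps)
    qed
    show "parabolic_cylinder_D \<nu> 0 = 2 powr (\<nu> / 2) * of_real (sqrt pi) * rGamma ((1 - \<nu>) / 2)"
      by (simp add: D y_def k_def A_def M0_def kummer_Phi_0 G)
    have c: "csqrt 2 = of_real (sqrt 2)" by (simp add: csqrt_of_real_nonneg[of 2, simplified])
    have s2: "2 / of_real (sqrt 2) = (of_real (sqrt 2) :: complex)"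
      by (metis of_real_divide of_real_numeral real_div_sqrt zero_le_numeral)
    have "B = - ((2 / of_real (sqrt 2)) * of_real (sqrt pi) * rGamma (- \<nu> / 2))"
      unfolding B_def G' c by simp
    then have "B = - (of_real (sqrt 2) * of_real (sqrt pi) * rGamma (- \<nu> / 2))"
      unfolding s2 .
    then show "D' 0 = - (2 powr (\<nu> / 2) * of_real (sqrt 2) * of_real (sqrt pi) * rGamma (- \<nu> / 2))"
      by (simp add: D'_def y'_def k_def O0_def kummer_Phi_0)
  qed
qed

section \<open>The product formula for positive real argument\<close>

lemma arc_laplace_power2_has_field_derivative:
  assumes "continuous_on UNIV g" "Re (z\<^sup>2) > 0"
  shows "((\<lambda>z. arc_laplace r g (z\<^sup>2 / 2)) has_field_derivative - z * arc_laplace (r - 1) g (z\<^sup>2 / 2)) (at z)"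
proof -
  have "((\<lambda>z. z\<^sup>2 / 2) has_field_derivative z) (at z)" by (auto intro!: derivative_eq_intros)
  moreover have "(arc_laplace r g has_field_derivative - arc_laplace (r - 1) g (z\<^sup>2 / 2)) (at (z\<^sup>2 / 2))"
    using assms by (intro arc_laplace_has_field_derivative) auto
  ultimately have "((\<lambda>z. arc_laplace r g (z\<^sup>2 / 2)) has_field_derivative - arc_laplace (r - 1) g (z\<^sup>2 / 2) * z) (at z)"
    by (rule DERIV_chain2[rotated])
  then show ?thesis by (simp add: mult.commute)
qed

text \<open>Integration by parts with q = sin(\<alpha> z). At w = z^2/2 it identifies the derivative
  of z times the integral with exponent -3/2 and amplitude sin z sin(\<alpha> z), which is the
  fourth equation of the system.\<close>

lemma arc_laplace_cos_eq_sin: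
  fixes \<alpha> w :: complex
  assumes w: "Re w > 0"
  shows "\<alpha> * arc_laplace (- 1 / 2) (\<lambda>z. cos (\<alpha> * z)) w
    = w * arc_laplace (- 5 / 2) (\<lambda>z. sin z * sin (\<alpha> * z)) w
      - arc_laplace (- 3 / 2) (\<lambda>z. sin z * sin (\<alpha> * z)) w / 2"
proof -
  have "arc_laplace (- 1 / 2) (\<lambda>z. \<alpha> * cos (\<alpha> * z)) w =
    w * arc_laplace (- 1 / 2 - 2) (\<lambda>z. sin z * sin (\<alpha> * z)) w
    + of_real (- 1 / 2) * arc_laplace (- 1 / 2 - 1) (\<lambda>z. sin z * sin (\<alpha> * z)) w"
    by (rule arc_laplace_by_parts) (use w in \<open>auto intro!: derivative_eq_intros continuous_intros\<close>)
  then show ?thesis by (simp add: arc_laplace_mult)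
qed

text \<open>Integration by parts with q = sin z cos(\<alpha> z). At w = z^2/2 it rewrites the second
  derivative of the main integral, where exponents -5/2 and -3/2 occur, by exponents -1/2 and 1/2,
  which stay finite at the origin.\<close>

lemma arc_laplace_sin_eq_cos:
  fixes \<alpha> w :: complex
  assumes w: "Re w > 0"
  defines "C \<equiv> \<lambda>z. cos (\<alpha> * z)"
  shows "arc_laplace (1 / 2) C w - \<alpha> * arc_laplace (- 1 / 2) (\<lambda>z. sin z * sin (\<alpha> * z)) w
    = w * (arc_laplace (- 5 / 2) C w - arc_laplace (- 1 / 2) C w)
      - (arc_laplace (- 3 / 2) C w - arc_laplace (1 / 2) C w) / 2"
proof -
  have C: "continuous_on UNIV C"
    unfolding C_def by (intro continuous_intros)
  have wr: "Re w > 0 \<or> Re w \<ge> 0 \<and> r > -1" for r :: real using w by simp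
  have "arc_laplace (- 1 / 2 + 1) C w + (- \<alpha>) * arc_laplace (- 1 / 2) (\<lambda>z. sin z * sin (\<alpha> * z)) w
      = arc_laplace (- 1 / 2) (\<lambda>z. cos z * C z + (- \<alpha>) * (sin z * sin (\<alpha> * z))) w"
    unfolding arc_laplace_mult[symmetric] arc_laplace_cos_mult[symmetric]
    by (intro arc_laplace_add[symmetric] wr continuous_intros C)
  also have "\<dots> = w * arc_laplace (- 1 / 2 - 2) (\<lambda>z. sin z * (sin z * C z)) w
    + of_real (- 1 / 2) * arc_laplace (- 1 / 2 - 1) (\<lambda>z. sin z * (sin z * C z)) w"
    by (rule arc_laplace_by_parts)
      (use w C in \<open>auto intro!: derivative_eq_intros continuous_intros simp: C_def algebra_simps\<close>)
  finally show ?thesis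
    unfolding arc_laplace_sin_squared_mult[OF C wr] by simp
qed

lemma parabolic_cylinder_product_positive:
  fixes \<nu> :: complex and x :: real
  assumes x: "x > 0"
  shows "parabolic_cylinder_D \<nu> (of_real x) * parabolic_cylinder_D (- \<nu> - 1) (of_real x)
    = arc_laplace (- 1 / 2) (\<lambda>z. cos ((\<nu> + 1 / 2) * z)) ((of_real x)\<^sup>2 / 2) / of_real (sqrt pi)"
proof -
  define \<alpha> where "\<alpha> = \<nu> + 1 / 2"
  define sp where "sp = complex_of_real (sqrt pi)"
  have sp: "sp \<noteq> 0" "sp * sp = of_real pi" by (simp_all add: sp_def flip: of_real_mult)
  define C where "C z = cos (\<alpha> * z)" for z :: complex
  define T where "T z = sin z * sin (\<alpha> * z)" for z :: complex
  have C: "continuous_on UNIV C" and T: "continuous_on UNIV T"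
    unfolding C_def T_def by (intro continuous_intros)+
  define L where "L r g z = arc_laplace r g (z\<^sup>2 / 2)" for r g and z :: complex
  have dL: "(L r g has_field_derivative - z * L (r - 1) g z) (at z)"
    if "continuous_on UNIV g" "Re (z\<^sup>2) > 0" for r g z
    unfolding L_def[abs_def] using that by (rule arc_laplace_power2_has_field_derivative)
  have ibp1: "2 * \<alpha> * L (- 1 / 2) C z = z\<^sup>2 * L (- 5 / 2) T z - L (- 3 / 2) T z" if "Re (z\<^sup>2) > 0" for z
    using arc_laplace_cos_eq_sin[of "z\<^sup>2 / 2" \<alpha>] that
    by (simp add: L_def C_def[abs_def] T_def[abs_def] field_simps)
  have ibp2: "2 * L (1 / 2) C z - 2 * \<alpha> * L (- 1 / 2) T z
      = z\<^sup>2 * (L (- 5 / 2) C z - L (- 1 / 2) C z) - (L (- 3 / 2) C z - L (1 / 2) C z)"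
    if "Re (z\<^sup>2) > 0" for z
  proof -
    have "L (1 / 2) C z - \<alpha> * L (- 1 / 2) T z
        = z\<^sup>2 / 2 * (L (- 5 / 2) C z - L (- 1 / 2) C z) - (L (- 3 / 2) C z - L (1 / 2) C z) / 2"
      unfolding L_def C_def[abs_def] T_def[abs_def] by (rule arc_laplace_sin_eq_cos) (use that in simp)
    then have "2 * (L (1 / 2) C z - \<alpha> * L (- 1 / 2) T z)
        = 2 * (z\<^sup>2 / 2 * (L (- 5 / 2) C z - L (- 1 / 2) C z) - (L (- 3 / 2) C z - L (1 / 2) C z) / 2)"
      by (rule arg_cong)
    also have "2 * (Z / 2 * X - Y / 2) = Z * X - Y" for X Y Z :: complex by simp
    finally show ?thesis by (simp only: right_diff_distrib mult.assoc)
  qed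
  \<comment> \<open>\<open>h\<close> is f' by differentiation under the integral, \<open>g\<close>
    is half of h' - (z^2/2) f after integration by parts, and \<open>w\<close> is read off from g'.
    Dividing by \<open>sp\<close> is the normalisation pi^(-1/2).\<close>
  define f where "f z = L (- 1 / 2) C z / sp" for z
  define h where "h z = - z * L (- 3 / 2) C z / sp" for z
  define g where "g z = (z\<^sup>2 / 2 * L (- 1 / 2) C z + L (1 / 2) C z - 2 * \<alpha> * L (- 1 / 2) T z) / (2 * sp)" for z
  define w where "w z = z * L (- 3 / 2) T z / sp" for z
  have dL1: "(L (- 1 / 2) C has_field_derivative - z * L (- 3 / 2) C z) (at z)"
    and dL2: "(L (1 / 2) C has_field_derivative - z * L (- 1 / 2) C z) (at z)"
    and dL3: "(L (- 3 / 2) C has_field_derivative - z * L (- 5 / 2) C z) (at z)"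
    and dL4: "(L (- 1 / 2) T has_field_derivative - z * L (- 3 / 2) T z) (at z)"
    and dL5: "(L (- 3 / 2) T has_field_derivative - z * L (- 5 / 2) T z) (at z)"
    if "Re (z\<^sup>2) > 0" for z
    using dL[OF C that, of "- 1 / 2"] dL[OF C that, of "1 / 2"] dL[OF C that, of "- 3 / 2"]
      dL[OF T that, of "- 1 / 2"] dL[OF T that, of "- 3 / 2"] by simp_all
  have df: "(f has_field_derivative h z) (at z)" if "Re (z\<^sup>2) > 0" for z
    unfolding f_def[abs_def] h_def by (rule DERIV_cdivide[OF dL1[OF that]])
  have dh: "(h has_field_derivative z\<^sup>2 / 2 * f z + 2 * g z) (at z)" if z: "Re (z\<^sup>2) > 0" for z
  proof -
    have "(h has_field_derivative (- 1 * L (- 3 / 2) C z + - z * L (- 5 / 2) C z * - z) / sp) (at z)"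
      unfolding h_def[abs_def] by (intro DERIV_cdivide DERIV_mult dL3 z DERIV_minus DERIV_ident)
    also have "(- 1 * L (- 3 / 2) C z + - z * L (- 5 / 2) C z * - z) / sp = z\<^sup>2 / 2 * f z + 2 * g z"
    proof -
      have "- 1 * L (- 3 / 2) C z + - z * L (- 5 / 2) C z * - z = z\<^sup>2 / 2 * L (- 1 / 2) C z
         + (z\<^sup>2 / 2 * L (- 1 / 2) C z + L (1 / 2) C z - 2 * \<alpha> * L (- 1 / 2) T z)"
        using ibp2[OF z] by (simp add: algebra_simps power2_eq_square)
      moreover have "2 * g z = (z\<^sup>2 / 2 * L (- 1 / 2) C z + L (1 / 2) C z - 2 * \<alpha> * L (- 1 / 2) T z) / sp"
      proof -
        have "2 * (Y / (2 * sp)) = Y / sp" for Y by simp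
        then show ?thesis unfolding g_def .
      qed
      ultimately show ?thesis unfolding f_def by (simp only: add_divide_distrib times_divide_eq_right)
    qed
    finally show ?thesis .
  qed
  have dg: "(g has_field_derivative z\<^sup>2 / 4 * h z + \<alpha> * w z) (at z)" if z: "Re (z\<^sup>2) > 0" for z
  proof -
    have "((\<lambda>z. z\<^sup>2 / 2) has_field_derivative z) (at z)" by (auto intro!: derivative_eq_intros)
    then have "(g has_field_derivative (z * L (- 1 / 2) C z + - z * L (- 3 / 2) C z * (z\<^sup>2 / 2)
        + - z * L (- 1 / 2) C z - 2 * \<alpha> * (- z * L (- 3 / 2) T z)) / (2 * sp)) (at z)"
      unfolding g_def[abs_def]
      by (intro DERIV_cdivide DERIV_diff DERIV_add DERIV_mult DERIV_cmult dL1 dL2 dL4 z)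
    also have "(z * L (- 1 / 2) C z + - z * L (- 3 / 2) C z * (z\<^sup>2 / 2)
        + - z * L (- 1 / 2) C z - 2 * \<alpha> * (- z * L (- 3 / 2) T z)) / (2 * sp) = z\<^sup>2 / 4 * h z + \<alpha> * w z"
      using sp by (simp add: h_def w_def field_simps)
    finally show ?thesis .
  qed
  have dw: "(w has_field_derivative - 2 * \<alpha> * f z) (at z)" if z: "Re (z\<^sup>2) > 0" for z
  proof -
    have "(w has_field_derivative (1 * L (- 3 / 2) T z + - z * L (- 5 / 2) T z * z) / sp) (at z)"
      unfolding w_def[abs_def] by (intro DERIV_cdivide DERIV_mult dL5 z DERIV_ident)
    also have "1 * L (- 3 / 2) T z + - z * L (- 5 / 2) T z * z = - (2 * \<alpha> * L (- 1 / 2) C z)"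
      using ibp1[OF z] by (simp add: power2_eq_square)
    also have "- (2 * \<alpha> * L (- 1 / 2) C z) / sp = - 2 * \<alpha> * f z" by (simp add: f_def)
    finally show ?thesis .
  qed
  \<comment> \<open>Exponents -1/2 and 1/2 are continuous at the origin; \<open>h\<close> and
    \<open>w\<close>, with exponent -3/2, go through the critical limit instead.\<close>
  have L0: "((\<lambda>x. L r k (of_real x)) \<longlongrightarrow> arc_laplace r k 0) (at_right (0::real))"
    if "continuous_on UNIV k" "r > -1" for r k
    unfolding L_def using that by (rule tendsto_arc_laplace_at_0)
  define Ja where "Ja = arc_laplace (- 1 / 2) C 0"
  define Jb where "Jb = arc_laplace (1 / 2) C 0"
  have s2: "complex_of_real (sqrt (2 * pi)) / sp = of_real (sqrt 2)"
    by (simp add: sp_def real_sqrt_mult)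
  have f0: "((\<lambda>x. f (of_real x)) \<longlongrightarrow> Ja / sp) (at_right (0::real))"
    unfolding f_def Ja_def using sp by (intro tendsto_intros L0 C) auto
  have h0: "((\<lambda>x. h (of_real x)) \<longlongrightarrow> - (of_real (sqrt 2) * cos (\<alpha> * of_real (pi / 2)))) (at_right (0::real))"
  proof -
    have dC: "(C has_field_derivative - \<alpha> * sin (\<alpha> * z)) (at z)" for z
      unfolding C_def[abs_def] by (auto intro!: derivative_eq_intros)
    have "((\<lambda>x. - (of_real x * L (- 3 / 2) C (of_real x)) / sp) \<longlongrightarrow> - (C (of_real (pi / 2)) * of_real (sqrt (2 * pi))) / sp) (at_right (0::real))"
      unfolding L_def using sp by (intro tendsto_intros tendsto_arc_laplace_critical[OF dC] continuous_intros) auto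
    also have "- (C (of_real (pi / 2)) * of_real (sqrt (2 * pi))) / sp = - (of_real (sqrt 2) * cos (\<alpha> * of_real (pi / 2)))"
      unfolding s2[symmetric] C_def by simp
    finally show ?thesis by (simp add: h_def)
  qed
  have w0: "((\<lambda>x. w (of_real x)) \<longlongrightarrow> of_real (sqrt 2) * sin (\<alpha> * of_real (pi / 2))) (at_right (0::real))"
  proof -
    have dT: "(T has_field_derivative cos z * sin (\<alpha> * z) + \<alpha> * cos (\<alpha> * z) * sin z) (at z)" for z
      unfolding T_def[abs_def] by (auto intro!: derivative_eq_intros)
    have "((\<lambda>x. of_real x * L (- 3 / 2) T (of_real x) / sp) \<longlongrightarrow> T (of_real (pi / 2)) * of_real (sqrt (2 * pi)) / sp) (at_right (0::real))"
      unfolding L_def using sp by (intro tendsto_intros tendsto_arc_laplace_critical[OF dT] continuous_intros) auto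
    also have "T (of_real (pi / 2)) * of_real (sqrt (2 * pi)) / sp = of_real (sqrt 2) * sin (\<alpha> * of_real (pi / 2))"
      unfolding s2[symmetric] T_def sin_of_real by simp
    finally show ?thesis by (simp add: w_def)
  qed
  \<comment> \<open>Integration by parts at w = 0 reduces this integral to \<open>Jb\<close>, so the
    limit of \<open>g\<close> also comes from a Cauchy integral.\<close>
  have X: "arc_laplace (- 1 / 2) T 0 = 2 * \<alpha> * Jb"
  proof -
    have "arc_laplace (1 / 2) (\<lambda>z. \<alpha> * C z) 0 =
      0 * arc_laplace (1 / 2 - 2) (\<lambda>z. sin z * sin (\<alpha> * z)) 0
      + of_real (1 / 2) * arc_laplace (1 / 2 - 1) (\<lambda>z. sin z * sin (\<alpha> * z)) 0"
      by (rule arc_laplace_by_parts)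
        (use C in \<open>auto intro!: derivative_eq_intros continuous_intros simp: C_def\<close>)
    then have "2 * \<alpha> * Jb = arc_laplace (- 1 / 2) T 0"
      by (simp add: arc_laplace_mult Jb_def T_def[abs_def] field_simps)
    then show ?thesis by (rule sym)
  qed
  have g0: "((\<lambda>x. g (of_real x)) \<longlongrightarrow> (1 - 4 * \<alpha>\<^sup>2) * Jb / (2 * sp)) (at_right (0::real))"
  proof -
    have "((\<lambda>x. g (of_real x)) \<longlongrightarrow> ((of_real 0)\<^sup>2 / 2 * Ja + Jb - 2 * \<alpha> * arc_laplace (- 1 / 2) T 0) / (2 * sp)) (at_right (0::real))"
      unfolding g_def Ja_def Jb_def using sp by (intro tendsto_intros L0 C T) auto
    also have "((of_real 0)\<^sup>2 / 2 * Ja + Jb - 2 * \<alpha> * arc_laplace (- 1 / 2) T 0) / (2 * sp) = (1 - 4 * \<alpha>\<^sup>2) * Jb / (2 * sp)"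
      unfolding X by (simp add: algebra_simps power2_eq_square)
    finally show ?thesis .
  qed
  obtain v' where v: "\<And>z. (parabolic_cylinder_D \<nu> has_field_derivative v' z) (at z)"
    "\<And>z. (v' has_field_derivative (z\<^sup>2 / 4 - \<nu> - 1 / 2) * parabolic_cylinder_D \<nu> z) (at z)"
    "parabolic_cylinder_D \<nu> 0 = 2 powr (\<nu> / 2) * of_real (sqrt pi) * rGamma ((1 - \<nu>) / 2)"
    "v' 0 = - (2 powr (\<nu> / 2) * of_real (sqrt 2) * of_real (sqrt pi) * rGamma (- \<nu> / 2))"
    using parabolic_cylinder_D_ODE by metis
  obtain u' where u: "\<And>z. (parabolic_cylinder_D (- \<nu> - 1) has_field_derivative u' z) (at z)"
    "\<And>z. (u' has_field_derivative (z\<^sup>2 / 4 - (- \<nu> - 1) - 1 / 2) * parabolic_cylinder_D (- \<nu> - 1) z) (at z)"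
    "parabolic_cylinder_D (- \<nu> - 1) 0 = 2 powr ((- \<nu> - 1) / 2) * of_real (sqrt pi) * rGamma ((1 - (- \<nu> - 1)) / 2)"
    "u' 0 = - (2 powr ((- \<nu> - 1) / 2) * of_real (sqrt 2) * of_real (sqrt pi) * rGamma (- (- \<nu> - 1) / 2))"
    using parabolic_cylinder_D_ODE by metis
  define V where "V = parabolic_cylinder_D \<nu>"
  define U where "U = parabolic_cylinder_D (- \<nu> - 1)"
  have dV: "(V has_field_derivative v' z) (at z)" "(v' has_field_derivative (z\<^sup>2 / 4 - \<alpha>) * V z) (at z)"
    and dU: "(U has_field_derivative u' z) (at z)" "(u' has_field_derivative (z\<^sup>2 / 4 + \<alpha>) * U z) (at z)" for z
    using v(1,2)[of z] u(1,2)[of z] by (simp_all add: U_def V_def \<alpha>_def algebra_simps)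
  have lim: "((\<lambda>x. k (of_real x)) \<longlongrightarrow> k 0) (at_right (0::real))"
    if "\<And>z. (k has_field_derivative k' z) (at z)" for k k' :: "complex \<Rightarrow> complex"
  proof -
    have "isCont (\<lambda>x. k (of_real x)) (0::real)"
      by (rule isCont_o2[where g = k]) (auto intro: DERIV_isCont[OF that] continuous_of_real)
    then show ?thesis by (auto simp: isCont_def filterlim_at_split)
  qed
  note lims = lim[OF dV(1)] lim[OF dV(2)] lim[OF dU(1)] lim[OF dU(2)]
  \<comment> \<open>The \<nu>-dependent powers of 2 cancel in every product of initial data of
    \<open>U\<close> and \<open>V\<close>.\<close>
  have pw: "2 powr ((- \<nu> - 1) / 2) * 2 powr (\<nu> / 2) = 1 / complex_of_real (sqrt 2)"
  proof -
    have "2 powr ((- \<nu> - 1) / 2) * 2 powr (\<nu> / 2) = (2::complex) powr ((- \<nu> - 1) / 2 + \<nu> / 2)"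
      by (simp add: powr_add)
    also have "(- \<nu> - 1) / 2 + \<nu> / 2 = of_real (- 1 / 2)" by (simp add: field_simps)
    also have "(2::complex) powr of_real (- 1 / 2) = of_real (2 powr (- 1 / 2))"
      using powr_of_real[of 2 "- 1 / 2"] by simp
    also have "2 powr (- 1 / 2) = 1 / sqrt (2::real)" by (simp add: powr_minus_divide powr_half_sqrt)
    finally show ?thesis by simp
  qed
  define t where "t = complex_of_real (sqrt 2)"
  have t: "t \<noteq> 0" "t * t = 2" by (simp_all add: t_def flip: of_real_mult)
  define A where "A = rGamma (1 + \<nu> / 2)"
  define A' where "A' = rGamma ((1 + \<nu>) / 2)"
  define B where "B = rGamma ((1 - \<nu>) / 2)"
  define B' where "B' = rGamma (- \<nu> / 2)"
  define PU where "PU = (2::complex) powr ((- \<nu> - 1) / 2)"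
  define PV where "PV = (2::complex) powr (\<nu> / 2)"
  have e1: "(1 - (- \<nu> - 1)) / 2 = 1 + \<nu> / 2" and e2: "- (- \<nu> - 1) / 2 = (1 + \<nu>) / 2" by (simp_all add: field_simps)
  have vals: "U 0 = PU * sp * A" "u' 0 = - (PU * t * sp * A')" "V 0 = PV * sp * B" "v' 0 = - (PV * t * sp * B')"
    unfolding U_def V_def u(3,4) v(3,4) e1 e2 A_def A'_def B_def B'_def t_def sp_def PU_def PV_def by (rule refl)+
  have PP: "PU * PV = t / 2"
  proof -
    have "1 / t = t / 2" using t by (simp add: field_simps)
    then show ?thesis using pw unfolding PU_def PV_def t_def[symmetric] by simp
  qed
  have cross: "PU * k * sp * a * (PV * l * sp * b) = k * l * (t / 2) * of_real pi * (a * b)" for k l a b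
  proof -
    have "PU * k * sp * a * (PV * l * sp * b) = k * l * (PU * PV) * (sp * sp) * (a * b)" by (simp only: mult_ac)
    then show ?thesis unfolding PP sp .
  qed
  have UV: "U 0 * V 0 = t / 2 * of_real pi * (A * B)"
    using cross[of 1 A 1 B] unfolding vals by simp
  have uV: "u' 0 * V 0 = - (of_real pi * (A' * B))"
    using cross[of t A' 1 B] t unfolding vals by simp
  have Uv: "U 0 * v' 0 = - (of_real pi * (A * B'))"
    using cross[of 1 A t B'] t unfolding vals by simp
  have uv: "u' 0 * v' 0 = t * of_real pi * (A' * B')"
    using cross[of t A' t B'] t unfolding vals by simp
  \<comment> \<open>Reflection formula: (1 + \<nu>)/2 and (1 - \<nu>)/2 sum to 1, as do 1 + \<nu>/2
    and -\<nu>/2 in \<open>BA\<close>. The mixed initial products thereby become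
    trigonometric.\<close>
  have AB: "of_real pi * (A' * B) = cos (of_real pi * (\<nu> / 2))"
  proof -
    have "A' * B = sin (of_real pi * ((1 + \<nu>) / 2)) / of_real pi"
      using rGamma_reflection_complex[of "(1 + \<nu>) / 2"] by (simp add: A'_def B_def field_simps)
    also have "of_real pi * ((1 + \<nu>) / 2) = of_real pi * (\<nu> / 2) + of_real (pi / 2)" by (simp add: field_simps)
    also have "sin \<dots> = cos (of_real pi * (\<nu> / 2))"
      unfolding sin_add sin_of_real cos_of_real by simp
    finally show ?thesis by simp
  qed
  have BA: "of_real pi * (A * B') = - sin (of_real pi * (\<nu> / 2))"
    using rGamma_reflection_complex[of "- \<nu> / 2"] by (simp add: A_def B'_def mult.commute)
  \<comment> \<open>The shift by pi/4 turns the cosine and sine of this angle into the difference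
    and sum of cos(pi \<nu>/2) and sin(pi \<nu>/2), divided by sqrt 2.\<close>
  have \<alpha>pi: "\<alpha> * of_real (pi / 2) = of_real pi * (\<nu> / 2) + of_real (pi / 4)"
    by (simp add: \<alpha>_def field_simps)
  have c4: "cos (complex_of_real (pi / 4)) = t / 2" "sin (complex_of_real (pi / 4)) = t / 2"
    unfolding sin_of_real cos_of_real cos_45 sin_45 by (simp_all add: t_def)
  have init_f: "Ja / sp = U 0 * V 0"
  proof -
    have a: "3 / 4 - \<alpha> / 2 = (1 - \<nu>) / 2" "3 / 4 + \<alpha> / 2 = 1 + \<nu> / 2" by (simp_all add: \<alpha>_def field_simps)
    have "Ja = t * of_real pi / 2 * sp * B * A"
      unfolding Ja_def C_def arc_laplace_cos_values a A_def B_def by (simp add: t_def sp_def)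
    then show ?thesis using sp unfolding UV by simp
  qed
  have init_h: "- (of_real (sqrt 2) * cos (\<alpha> * of_real (pi / 2))) = u' 0 * V 0 + U 0 * v' 0"
  proof -
    have "t * cos (\<alpha> * of_real (pi / 2)) = t * t / 2 * (cos (of_real pi * (\<nu> / 2)) - sin (of_real pi * (\<nu> / 2)))"
      unfolding \<alpha>pi cos_add c4 by (simp add: algebra_simps)
    then show ?thesis unfolding uV Uv AB BA t_def[symmetric] t by simp
  qed
  have init_w: "of_real (sqrt 2) * sin (\<alpha> * of_real (pi / 2)) = U 0 * v' 0 - u' 0 * V 0"
  proof -
    have "t * sin (\<alpha> * of_real (pi / 2)) = t * t / 2 * (cos (of_real pi * (\<nu> / 2)) + sin (of_real pi * (\<nu> / 2)))"
      unfolding \<alpha>pi sin_add c4 by (simp add: algebra_simps)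
    then show ?thesis unfolding uV Uv AB BA t_def[symmetric] t by simp
  qed
  \<comment> \<open>Since \<alpha> = \<nu> + 1/2, one has 1 - 4 \<alpha>^2 = -4 \<nu> (\<nu> + 1);
    these factors are absorbed by shifting both reciprocal Gammas by one.\<close>
  have init_g: "(1 - 4 * \<alpha>\<^sup>2) * Jb / (2 * sp) = u' 0 * v' 0"
  proof -
    define D1 where "D1 = rGamma (1 - \<nu> / 2)"
    define D2 where "D2 = rGamma ((3 + \<nu>) / 2)"
    have a: "5 / 4 - \<alpha> / 2 = 1 - \<nu> / 2" "5 / 4 + \<alpha> / 2 = (3 + \<nu>) / 2" by (simp_all add: \<alpha>_def field_simps)
    have B': "B' = - \<nu> / 2 * D1" and A': "A' = (1 + \<nu>) / 2 * D2"
      using rGamma_plus1[of "- \<nu> / 2"] rGamma_plus1[of "(1 + \<nu>) / 2"]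
      by (simp_all add: B'_def A'_def D1_def D2_def add_divide_distrib add.commute)
    have Jb: "Jb = t * of_real pi / 4 * (sp / 2) * D1 * D2"
      unfolding Jb_def C_def arc_laplace_cos_values a D1_def D2_def by (simp add: t_def sp_def)
    show ?thesis unfolding uv A' B' \<alpha>_def Jb using sp(1) by (simp add: field_simps power2_eq_square)
  qed
  \<comment> \<open>The system is linear, so the componentwise differences solve it with zero limits
    at the origin.\<close>
  have "f (of_real x) - U (of_real x) * V (of_real x) = 0"
  proof (rule product_system_unique[where \<alpha> = \<alpha>
        and h = "\<lambda>x. h (of_real x) - (u' (of_real x) * V (of_real x) + U (of_real x) * v' (of_real x))"
        and g = "\<lambda>x. g (of_real x) - u' (of_real x) * v' (of_real x)"
        and w = "\<lambda>x. w (of_real x) - (U (of_real x) * v' (of_real x) - u' (of_real x) * V (of_real x))"])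
    fix y :: real assume y: "y > 0"
    then have Re_y: "Re ((complex_of_real y)\<^sup>2) > 0" by (simp flip: of_real_power)
    have "((\<lambda>z. f z - U z * V z) has_field_derivative h (of_real y) - (u' (of_real y) * V (of_real y) + U (of_real y) * v' (of_real y))) (at (of_real y))"
      by (auto intro!: derivative_eq_intros df[OF Re_y] dU dV)
    then show "((\<lambda>x. f (of_real x) - U (of_real x) * V (of_real x)) has_vector_derivative
        h (of_real y) - (u' (of_real y) * V (of_real y) + U (of_real y) * v' (of_real y))) (at y)"
      by (rule has_vector_derivative_real_field)
    have "((\<lambda>z. h z - (u' z * V z + U z * v' z)) has_field_derivative
        (of_real y)\<^sup>2 / 2 * (f (of_real y) - U (of_real y) * V (of_real y)) + 2 * (g (of_real y) - u' (of_real y) * v' (of_real y))) (at (of_real y))"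
      by (auto intro!: derivative_eq_intros dh[OF Re_y] dU dV simp: algebra_simps)
    then show "((\<lambda>x. h (of_real x) - (u' (of_real x) * V (of_real x) + U (of_real x) * v' (of_real x))) has_vector_derivative
        (of_real y)\<^sup>2 / 2 * (f (of_real y) - U (of_real y) * V (of_real y)) + 2 * (g (of_real y) - u' (of_real y) * v' (of_real y))) (at y)"
      by (rule has_vector_derivative_real_field)
    have "((\<lambda>z. g z - u' z * v' z) has_field_derivative
        (of_real y)\<^sup>2 / 4 * (h (of_real y) - (u' (of_real y) * V (of_real y) + U (of_real y) * v' (of_real y)))
        + \<alpha> * (w (of_real y) - (U (of_real y) * v' (of_real y) - u' (of_real y) * V (of_real y)))) (at (of_real y))"
      by (auto intro!: derivative_eq_intros dg[OF Re_y] dU dV simp: algebra_simps)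
    then show "((\<lambda>x. g (of_real x) - u' (of_real x) * v' (of_real x)) has_vector_derivative
        (of_real y)\<^sup>2 / 4 * (h (of_real y) - (u' (of_real y) * V (of_real y) + U (of_real y) * v' (of_real y)))
        + \<alpha> * (w (of_real y) - (U (of_real y) * v' (of_real y) - u' (of_real y) * V (of_real y)))) (at y)"
      by (rule has_vector_derivative_real_field)
    have "((\<lambda>z. w z - (U z * v' z - u' z * V z)) has_field_derivative
        - 2 * \<alpha> * (f (of_real y) - U (of_real y) * V (of_real y))) (at (of_real y))"
      by (auto intro!: derivative_eq_intros dw[OF Re_y] dU dV simp: algebra_simps)
    then show "((\<lambda>x. w (of_real x) - (U (of_real x) * v' (of_real x) - u' (of_real x) * V (of_real x))) has_vector_derivative
        - 2 * \<alpha> * (f (of_real y) - U (of_real y) * V (of_real y))) (at y)"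
      by (rule has_vector_derivative_real_field)
  next
    have "((\<lambda>x. f (of_real x) - U (of_real x) * V (of_real x)) \<longlongrightarrow> Ja / sp - U 0 * V 0) (at_right (0::real))"
      by (intro tendsto_intros f0 lims)
    then show "((\<lambda>x. f (of_real x) - U (of_real x) * V (of_real x)) \<longlongrightarrow> 0) (at_right (0::real))"
      by (simp add: init_f)
    have "((\<lambda>x. h (of_real x) - (u' (of_real x) * V (of_real x) + U (of_real x) * v' (of_real x))) \<longlongrightarrow>
        - (of_real (sqrt 2) * cos (\<alpha> * of_real (pi / 2))) - (u' 0 * V 0 + U 0 * v' 0)) (at_right (0::real))"
      by (intro tendsto_intros h0 lims)
    then show "((\<lambda>x. h (of_real x) - (u' (of_real x) * V (of_real x) + U (of_real x) * v' (of_real x))) \<longlongrightarrow> 0) (at_right (0::real))"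
      unfolding init_h by simp
    have "((\<lambda>x. g (of_real x) - u' (of_real x) * v' (of_real x)) \<longlongrightarrow> (1 - 4 * \<alpha>\<^sup>2) * Jb / (2 * sp) - u' 0 * v' 0) (at_right (0::real))"
      by (intro tendsto_intros g0 lims)
    then show "((\<lambda>x. g (of_real x) - u' (of_real x) * v' (of_real x)) \<longlongrightarrow> 0) (at_right (0::real))"
      unfolding init_g by simp
    have "((\<lambda>x. w (of_real x) - (U (of_real x) * v' (of_real x) - u' (of_real x) * V (of_real x))) \<longlongrightarrow>
        of_real (sqrt 2) * sin (\<alpha> * of_real (pi / 2)) - (U 0 * v' 0 - u' 0 * V 0)) (at_right (0::real))"
      by (intro tendsto_intros w0 lims)
    then show "((\<lambda>x. w (of_real x) - (U (of_real x) * v' (of_real x) - u' (of_real x) * V (of_real x))) \<longlongrightarrow> 0) (at_right (0::real))"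
      unfolding init_w by simp
  qed (rule x)
  then show ?thesis
    by (simp add: f_def L_def U_def V_def C_def[abs_def] sp_def \<alpha>_def mult.commute)
qed

section \<open>Analytic continuation in \<open>p\<close>\<close>

lemma parabolic_cylinder_product:
  fixes \<nu> p :: complex and a :: real
  assumes a: "a > 0" and p: "Re p > 0"
  shows "parabolic_cylinder_D \<nu> (of_real a * csqrt p) * parabolic_cylinder_D (- \<nu> - 1) (of_real a * csqrt p)
    = arc_laplace (- 1 / 2) (\<lambda>z. cos ((\<nu> + 1 / 2) * z)) (of_real (a\<^sup>2 / 2) * p) / of_real (sqrt pi)"
proof -
  define F where "F p = parabolic_cylinder_D \<nu> (of_real a * csqrt p) * parabolic_cylinder_D (- \<nu> - 1) (of_real a * csqrt p)
    - arc_laplace (- 1 / 2) (\<lambda>z. cos ((\<nu> + 1 / 2) * z)) (of_real (a\<^sup>2 / 2) * p) / of_real (sqrt pi)" for p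
  have D: "parabolic_cylinder_D \<mu> field_differentiable at z" for \<mu> z
    using parabolic_cylinder_D_ODE[of \<mu>] field_differentiable_def by metis
  have c: "continuous_on UNIV (\<lambda>z. cos ((\<nu> + 1 / 2) * z))" by (intro continuous_intros)
  have "F p = 0"
  proof (rule analytic_continuation[of F "{z. Re z > 0}" "of_real ` {0<..}" 1])
    show "F holomorphic_on {z. Re z > 0}"
      unfolding holomorphic_on_def
    proof
      fix z assume "z \<in> {z. Re z > 0}"
      then have z: "Re z > 0" by simp
      then have "z \<notin> \<real>\<^sub>\<le>\<^sub>0" by (auto simp: complex_nonpos_Reals_iff)
      then have "csqrt field_differentiable at z" by (rule field_differentiable_at_csqrt)
      then have s: "(\<lambda>z. of_real a * csqrt z) field_differentiable at z"
        by (intro field_differentiable_mult) auto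
      have D': "(\<lambda>z. parabolic_cylinder_D \<mu> (of_real a * csqrt z)) field_differentiable at z" for \<mu>
        using field_differentiable_compose[OF s D] by (simp add: o_def)
      have w: "Re (of_real (a\<^sup>2 / 2) * z) > 0" using z a by simp
      have "arc_laplace (- 1 / 2) (\<lambda>z. cos ((\<nu> + 1 / 2) * z)) field_differentiable at (of_real (a\<^sup>2 / 2) * z)"
        using arc_laplace_has_field_derivative[OF c w] field_differentiable_def by blast
      moreover have "(\<lambda>z. of_real (a\<^sup>2 / 2) * z) field_differentiable at z"
        by (intro field_differentiable_mult) auto
      ultimately have L: "(\<lambda>z. arc_laplace (- 1 / 2) (\<lambda>z. cos ((\<nu> + 1 / 2) * z)) (of_real (a\<^sup>2 / 2) * z)) field_differentiable at z"
        using field_differentiable_compose by (fastforce simp: o_def)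
      have "F field_differentiable at z" unfolding F_def[abs_def]
        by (intro field_differentiable_diff field_differentiable_mult D' field_differentiable_divide L field_differentiable_const) simp
      then show "F field_differentiable at z within {z. Re z > 0}" by (rule field_differentiable_at_within)
    qed
    show "open {z. Re z > 0}" by (rule open_halfspace_Re_gt)
    show "connected {z. Re z > 0}" by (rule convex_connected) (rule convex_halfspace_Re_gt)
    show "(of_real ` {0<..} :: complex set) \<subseteq> {z. Re z > 0}" by auto
    show "(1::complex) islimpt of_real ` {0<..}"
    proof (rule islimpt_approachable[THEN iffD2], intro allI impI)
      fix e :: real assume e: "e > 0"
      have "dist (complex_of_real (1 + e / 2)) 1 = e / 2"
        using e by (simp add: dist_norm norm_mult)
      then show "\<exists>x'\<in>of_real ` {0<..}. x' \<noteq> (1::complex) \<and> dist x' 1 < e"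
        using e by (intro bexI[of _ "of_real (1 + e / 2)"] imageI conjI) (auto simp flip: of_real_add)
    qed
    \<comment> \<open>On the positive axis \<open>csqrt\<close> is the real square root, and x = a
      sqrt r gives x^2/2 = (a^2/2) r.\<close>
    show "F z = 0" if zr: "z \<in> of_real ` {0<..}" for z
    proof -
      obtain r where r: "r > 0" "z = of_real r" using zr by auto
      have s: "of_real a * csqrt z = of_real (a * sqrt r)"
        using r by (simp add: csqrt_of_real_nonneg)
      have q: "(complex_of_real (a * sqrt r))\<^sup>2 / 2 = of_real (a\<^sup>2 / 2) * z"
      proof -
        have "(a * sqrt r)\<^sup>2 / 2 = a\<^sup>2 / 2 * r" using r by (simp add: power_mult_distrib)
        then show ?thesis unfolding r(2) by (metis of_real_divide of_real_mult of_real_numeral of_real_power)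
      qed
      have "a * sqrt r > 0" using a r by simp
      from parabolic_cylinder_product_positive[OF this, of \<nu>] show ?thesis
        unfolding F_def s q by simp
    qed
  qed (use p in auto)
  then show ?thesis by (simp add: F_def)
qed

section \<open>Return to the integral over \<open>t\<close>\<close>

lemma arcsin_sqrt_half_angle:
  assumes "0 \<le> x" "x \<le> pi"
  shows "arcsin (sqrt ((1 - cos x) / 2)) = x / 2"
proof -
  have "(1 - cos x) / 2 = (sin (x / 2))\<^sup>2" by (simp add: cos_eq_half_angle[of x])
  moreover have "sin (x / 2) \<ge> 0" using assms by (intro sin_ge_zero) auto
  ultimately have "sqrt ((1 - cos x) / 2) = sin (x / 2)" by simp
  then show ?thesis using assms by (simp add: arcsin_sin)
qed

theorem theorem4p1:
  fixes \<nu> p :: complex and a :: real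
  assumes "a > 0" and "Re p > 0"
  defines "f \<equiv> (\<lambda>t::real. exp (- p * complex_of_real t)
      * complex_of_real (a * (t ^ 2 - a ^ 4 / 4) powr (- 1 / 2) / sqrt (2 * pi * t))
      * cos ((2 * \<nu> + 1) * complex_of_real (arcsin (sqrt ((2 * t - a ^ 2) / (4 * t))))))"
  shows "set_integrable lborel {a ^ 2 / 2<..} f \<and>
    parabolic_cylinder_D \<nu> (complex_of_real a * csqrt p)
      * parabolic_cylinder_D (- \<nu> - 1) (complex_of_real a * csqrt p)
    = (LBINT t:{a ^ 2 / 2<..}. f t)"
proof -
  note a = \<open>a > 0\<close> and p = \<open>Re p > 0\<close>
  define w where "w = of_real (a\<^sup>2 / 2) * p"
  define C where "C z = cos ((\<nu> + 1 / 2) * z)" for z :: complex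
  define E where "E x = exp (- w / of_real (cos x)) * of_real (cos x powr (- 1 / 2)) * C (of_real x)" for x :: real
  define g where "g x = a\<^sup>2 / 2 / cos x" for x :: real
  define g' where "g' x = a\<^sup>2 / 2 * sin x / (cos x)\<^sup>2" for x :: real
  have Cc: "continuous_on UNIV C" unfolding C_def by (intro continuous_intros)
  have w: "Re w > 0" using a p by (simp add: w_def)
  have iE: "integrable quarter E" unfolding E_def using w by (intro integrable_arc_laplace Cc) auto
  have fg: "g' x *\<^sub>R f (g x) = E x / of_real (sqrt pi)" if x: "x \<in> {0<..<pi/2}" for x
  proof -
    have c: "cos x > 0" using x by (simp add: cos_gt_zero)
    have s: "sin x > 0" using x by (intro sin_gt_zero) auto
    have "(2 * g x - a\<^sup>2) / (4 * g x) = (1 - cos x) / 2"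
      using a c by (simp add: g_def field_simps power2_eq_square)
    \<comment> \<open>With t = g(x) the radicand is sin^2(x/2), so the angle (2 \<nu> + 1) x/2 is
      \<alpha> x.\<close>
    then have arc: "arcsin (sqrt ((2 * g x - a\<^sup>2) / (4 * g x))) = x / 2"
      using arcsin_sqrt_half_angle[of x] x by (simp only:) simp
    \<comment> \<open>Here t^2 - a^4/4 = ((a^2/2) tan x)^2, whose inverse square root cancels the
      sine in \<open>g'\<close>; 1 / sqrt(pi cos x) remains.\<close>
    have "(g x)\<^sup>2 - a ^ 4 / 4 = (a\<^sup>2 / 2)\<^sup>2 * (1 - (cos x)\<^sup>2) / (cos x)\<^sup>2"
      using c by (simp add: g_def power_divide field_simps flip: power_mult)
    also have "1 - (cos x)\<^sup>2 = (sin x)\<^sup>2" by (simp add: sin_squared_eq)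
    also have "(a\<^sup>2 / 2)\<^sup>2 * (sin x)\<^sup>2 / (cos x)\<^sup>2 = (a\<^sup>2 / 2 * sin x / cos x)\<^sup>2"
      by (simp add: power_divide power_mult_distrib)
    finally have pw: "((g x)\<^sup>2 - a ^ 4 / 4) powr (- 1 / 2) = cos x / (a\<^sup>2 / 2 * sin x)"
      using a c s by (simp add: powr_minus_divide powr_half_sqrt)
    have "2 * pi * g x = pi * a\<^sup>2 / cos x" by (simp add: g_def)
    then have sq: "sqrt (2 * pi * g x) = sqrt pi * a / sqrt (cos x)"
      using a by (simp add: real_sqrt_mult real_sqrt_divide)
    have "g' x * (a * ((g x)\<^sup>2 - a ^ 4 / 4) powr (- 1 / 2) / sqrt (2 * pi * g x)) = 1 / sqrt (cos x) / sqrt pi"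
    proof -
      have "sqrt (cos x) * sqrt (cos x) = cos x" using c by simp
      then have "sqrt (cos x) / cos x = 1 / sqrt (cos x)" using c by (simp add: field_simps)
      moreover have "g' x * (a * ((g x)\<^sup>2 - a ^ 4 / 4) powr (- 1 / 2) / sqrt (2 * pi * g x)) = sqrt (cos x) / cos x / sqrt pi"
        unfolding pw sq g'_def using a c s by (simp add: field_simps power2_eq_square)
      ultimately show ?thesis by simp
    qed
    also have "1 / sqrt (cos x) = cos x powr (- 1 / 2)" using c by (simp add: powr_minus_divide powr_half_sqrt)
    finally have amp: "g' x * (a * ((g x)\<^sup>2 - a ^ 4 / 4) powr (- 1 / 2) / sqrt (2 * pi * g x)) = cos x powr (- 1 / 2) / sqrt pi" .
    have ex: "- p * of_real (g x) = - w / of_real (cos x)" by (simp add: w_def g_def)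
    have an: "(2 * \<nu> + 1) * complex_of_real (x / 2) = (\<nu> + 1 / 2) * of_real x" by (simp add: field_simps)
    have "g' x *\<^sub>R f (g x) = exp (- w / of_real (cos x))
        * of_real (g' x * (a * ((g x)\<^sup>2 - a ^ 4 / 4) powr (- 1 / 2) / sqrt (2 * pi * g x))) * C (of_real x)"
      unfolding f_def arc ex an C_def scaleR_conv_of_real of_real_mult by (simp only: mult_ac)
    then show ?thesis unfolding amp E_def by simp
  qed
  have dg: "(g has_real_derivative g' x) (at x)" if "x \<in> {0<..<pi/2}" for x
    unfolding g_def[abs_def] g'_def using that cos_gt_zero[of x]
    by (auto intro!: derivative_eq_intros simp: power2_eq_square)
  have g'_nonneg: "g' x \<ge> 0" if "0 \<le> x" "x \<le> pi/2" for x
    unfolding g'_def using that by (intro divide_nonneg_nonneg mult_nonneg_nonneg sin_ge_zero) auto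
  have g_gt: "g x > a\<^sup>2 / 2" if "x \<in> {0<..<pi/2}" for x
  proof -
    have "cos x < 1" using cos_monotone_0_pi[of 0 x] that by simp
    moreover have "cos x > 0" using that by (simp add: cos_gt_zero)
    ultimately show ?thesis using a by (simp add: g_def field_simps)
  qed
  have f_cont: "isCont f t" if t: "t > a\<^sup>2 / 2" for t
  proof -
    have "0 < a\<^sup>2 / 2" using a by simp
    then have t0: "t > 0" using t by linarith
    have "(a\<^sup>2 / 2)\<^sup>2 < t\<^sup>2" using t a by (intro power_strict_mono) auto
    then have "t\<^sup>2 - a ^ 4 / 4 > 0" by (simp add: power_divide flip: power_mult)
    then have c1: "isCont (\<lambda>t. (t\<^sup>2 - a ^ 4 / 4) powr (- 1 / 2)) t"
      by (intro continuous_intros) auto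
    have "2 * t - a\<^sup>2 < 1 * (4 * t)" using t0 zero_le_power2[of a] by linarith
    then have "(2 * t - a\<^sup>2) / (4 * t) < 1" using t0 by (simp add: pos_divide_less_eq)
    then have "sqrt ((2 * t - a\<^sup>2) / (4 * t)) < 1" by simp
    moreover have "0 \<le> sqrt ((2 * t - a\<^sup>2) / (4 * t))" using t t0 by simp
    then have "- 1 < sqrt ((2 * t - a\<^sup>2) / (4 * t))" by linarith
    ultimately have "isCont arcsin (sqrt ((2 * t - a\<^sup>2) / (4 * t)))"
      by (intro isCont_arcsin)
    moreover have "isCont (\<lambda>t. sqrt ((2 * t - a\<^sup>2) / (4 * t))) t"
      using t0 by (intro continuous_intros) auto
    ultimately have c2: "isCont (\<lambda>t. arcsin (sqrt ((2 * t - a\<^sup>2) / (4 * t)))) t"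
      by (rule isCont_o2[rotated])
    show ?thesis unfolding f_def using t0
      by (intro isCont_mult continuous_of_real isCont_divide isCont_cos' isCont_exp' c1 c2 continuous_intros) auto
  qed
  have lim0: "((ereal \<circ> g \<circ> real_of_ereal) \<longlongrightarrow> ereal (a\<^sup>2 / 2)) (at_right (ereal 0))"
  proof -
    have "isCont g 0" unfolding g_def[abs_def] by (intro continuous_intros) auto
    then show ?thesis
      unfolding ereal_tendsto_simps
      by (auto simp: isCont_def filterlim_at_split g_def)
  qed
  have lim1: "((ereal \<circ> g \<circ> real_of_ereal) \<longlongrightarrow> \<infinity>) (at_left (ereal (pi/2)))"
    unfolding ereal_tendsto_simps
  proof -
    have "filterlim (\<lambda>c. a\<^sup>2 / 2 / c) at_top (at_right (0::real))"
      using a by real_asymp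
    then show "filterlim g at_top (at_left (pi/2))"
      unfolding g_def by (rule filterlim_compose[OF _ filterlim_cos_at_left_half_pi])
  qed
  have isCont_g': "isCont g' x" if "x \<in> {0<..<pi/2}" for x
    unfolding g'_def[abs_def] using that cos_gt_zero[of x] by (intro continuous_intros) auto
  have pi2: "ereal 0 < ereal (pi/2)" by simp
  have ein: "einterval (ereal (a\<^sup>2 / 2)) \<infinity> = {a\<^sup>2 / 2<..}" by (auto simp: einterval_def)
  have iE': "integrable quarter (\<lambda>x. E x / of_real (sqrt pi))" using iE by simp
  have int_fg: "set_integrable lborel (einterval (ereal 0) (ereal (pi/2))) (\<lambda>x. g' x *\<^sub>R f (g x))"
  proof -
    have "integrable quarter (\<lambda>x. g' x *\<^sub>R f (g x))"
      using iE' by (rule Bochner_Integration.integrable_cong[THEN iffD2, rotated -1]) (auto simp: fg)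
    then show ?thesis by (simp add: integrable_quarter_iff)
  qed
  \<comment> \<open>For a nonnegative integrand the substitution theorem also delivers integrability
    on the infinite ray; it is applied to the norm, which dominates the complex integrand.\<close>
  have int_norm: "set_integrable lborel (einterval (ereal (a\<^sup>2 / 2)) \<infinity>) (\<lambda>t. norm (f t))"
  proof (rule interval_integral_substitution_nonneg(1)[OF pi2 _ _ _ _ _ lim0 lim1])
    have "integrable quarter (\<lambda>x. norm (g' x *\<^sub>R f (g x)))"
      using int_fg by (intro integrable_norm) (simp add: integrable_quarter_iff)
    moreover have "norm (g' x *\<^sub>R f (g x)) = norm (f (g x)) * g' x" if "x \<in> {0<..<pi/2}" for x
      using g'_nonneg[of x] that by simp
    ultimately have "integrable quarter (\<lambda>x. norm (f (g x)) * g' x)"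
      by (subst (asm) Bochner_Integration.integrable_cong[OF refl, of _ _ "\<lambda>x. norm (f (g x)) * g' x"]) auto
    then show "set_integrable lborel (einterval (ereal 0) (ereal (pi/2))) (\<lambda>x. norm (f (g x)) * g' x)"
      by (simp add: integrable_quarter_iff)
    show "isCont (\<lambda>t. norm (f t)) (g x)" if "ereal 0 < ereal x" "ereal x < ereal (pi/2)" for x
      using that by (intro continuous_norm f_cont g_gt) auto
  qed (use dg isCont_g' g'_nonneg in auto)
  have int_f: "set_integrable lborel {a\<^sup>2 / 2<..} f"
    unfolding set_integrable_def
  proof (rule Bochner_Integration.integrable_bound)
    show "integrable lborel (\<lambda>x. indicator {a\<^sup>2 / 2<..} x *\<^sub>R norm (f x))"
      using int_norm unfolding ein set_integrable_def .
    have "continuous_on {a\<^sup>2 / 2<..} f"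
      using f_cont by (intro continuous_at_imp_continuous_on) auto
    then show "(\<lambda>x. indicator {a\<^sup>2 / 2<..} x *\<^sub>R f x) \<in> borel_measurable lborel"
      using borel_measurable_continuous_on_indicator[of "{a\<^sup>2 / 2<..}" f] by simp
  qed (auto intro!: AE_I2)
  have "(LBINT t:{a\<^sup>2 / 2<..}. f t) = (LBINT t=ereal (a\<^sup>2 / 2)..\<infinity>. f t)"
    by (simp add: interval_lebesgue_integral_le_eq ein)
  also have "\<dots> = (LBINT x=ereal 0..ereal (pi/2). g' x *\<^sub>R f (g x))"
    by (rule interval_integral_substitution_integrable[OF pi2 _ _ _ _ lim0 lim1 int_fg])
      (use int_f ein dg isCont_g' g'_nonneg f_cont g_gt in auto)
  also have "\<dots> = integral\<^sup>L quarter (\<lambda>x. g' x *\<^sub>R f (g x))"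
    by (simp add: integral_quarter_eq interval_lebesgue_integral_le_eq)
  also have "\<dots> = integral\<^sup>L quarter (\<lambda>x. E x / of_real (sqrt pi))"
    by (rule Bochner_Integration.integral_cong) (auto simp: fg)
  also have "\<dots> = arc_laplace (- 1 / 2) C w / of_real (sqrt pi)"
    by (simp add: arc_laplace_def E_def)
  also have "\<dots> = parabolic_cylinder_D \<nu> (of_real a * csqrt p) * parabolic_cylinder_D (- \<nu> - 1) (of_real a * csqrt p)"
    unfolding parabolic_cylinder_product[OF a p] w_def C_def ..
  finally show ?thesis using int_f by simp
qed

end
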